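(* Let $0<a<1$ and $0<\alpha\le 2$. Suppose $u=u(x,t):\mathbb{R}\times(-\infty,0]\to\mathbb{R}$ satisfies $$\sup_{(x,t)\in\mathbb{R}\times(-\infty,0]}|x|^a|u(x,t)|\le C$$ for some $C>0$. If $u$ is an ancient solution to the equation $$\partial_t u=-\Lambda^\alpha u,\qquad (x,t)\in\mathbb{R}\times(-\infty,0],$$ where $\Lambda=(-\Delta)^{\frac12}$, then $u\equiv0$.
   Context: $\Lambda^\alpha=(-\Delta)^{\alpha/2}$ is the Fourier multiplier operator with symbol $|\xi|^\alpha$ acting in the space variable $x\in\mathbb{R}$. For each $t$, the decay hypothesis makes $u(\cdot,t)$ a locally integrable function defining a tempered distribution on $\mathbb{R}$, and the equation is understood in the corresponding sense (pairing with Schwartz functions $\varphi$ in $x$, $\langle\Lambda^\alpha u,\varphi\rangle=\int_{\mathbb{R}}u\,\Lambda^\alpha\varphi\,dx$). An ancient solution is a solution defined for all $t\in(-\infty,0]$. *)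

theory Defs
  imports "HOL-Analysis.Analysis"
begin

definition schwartz :: "(real \<Rightarrow> complex) \<Rightarrow> bool" where
  "schwartz \<phi> \<longleftrightarrow>
     (\<exists>D :: nat \<Rightarrow> real \<Rightarrow> complex.
        D 0 = \<phi> \<and>
        (\<forall>m x. (D m has_vector_derivative D (Suc m) x) (at x)) \<and>
        (\<forall>k m. \<exists>B. \<forall>x. \<bar>x\<bar> ^ k * norm (D m x) \<le> B))"

definition fourier :: "(real \<Rightarrow> complex) \<Rightarrow> real \<Rightarrow> complex" where
  "fourier \<phi> \<xi> = (LINT x|lborel. cis (- (x * \<xi>)) * \<phi> x)"

definition inverse_fourier :: "(real \<Rightarrow> complex) \<Rightarrow> real \<Rightarrow> complex" where
  "inverse_fourier g x = (LINT \<xi>|lborel. cis (x * \<xi>) * g \<xi>) / (2 * pi)"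

text \<open>
  The Fourier multiplier with symbol \<open>\<bar>\<xi>\<bar>\<close> to the power \<open>\<alpha>\<close>. For \<open>\<alpha> > 0\<close> the convention
  \<open>0 powr \<alpha> = 0\<close> gives the right value of the symbol at the origin.
\<close>
definition Lambda :: "real \<Rightarrow> (real \<Rightarrow> complex) \<Rightarrow> real \<Rightarrow> complex" where
  "Lambda \<alpha> \<phi> = inverse_fourier (\<lambda>\<xi>. complex_of_real (\<bar>\<xi>\<bar> powr \<alpha>) * fourier \<phi> \<xi>)"

definition pairing :: "(real \<Rightarrow> real) \<Rightarrow> (real \<Rightarrow> complex) \<Rightarrow> complex" where
  "pairing f \<phi> = (LINT x|lebesgue. complex_of_real (f x) * \<phi> x)"

text \<open>
  The equation \<open>\<partial>\<^sub>t u = - \<Lambda>\<^sup>\<alpha> u\<close> for all times \<open>t \<le> 0\<close>, in the sense of tempered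
  distributions in the space variable: each pairing with a Schwartz function is differentiable
  in time (from the left at \<open>t = 0\<close>). Values of \<open>u\<close> at positive times are irrelevant.
  The definition is meant for \<open>u\<close> whose time slices are measurable and bounded by a multiple of
  \<open>\<bar>x\<bar> powr (- a)\<close> off the origin, for some \<open>0 < a < 1\<close>. As \<open>Lambda \<alpha> \<phi>\<close> is bounded and decays
  at least like \<open>\<bar>x\<bar> powr (- 1 - \<alpha>)\<close>, both integrals then converge absolutely.
\<close>
definition ancient_solution :: "real \<Rightarrow> (real \<Rightarrow> real \<Rightarrow> real) \<Rightarrow> bool" where
  "ancient_solution \<alpha> u \<longleftrightarrow>
     (\<forall>\<phi>. schwartz \<phi> \<longrightarrow>
        (\<forall>t\<le>0. ((\<lambda>s. pairing (\<lambda>x. u x s) \<phi>) has_vector_derivative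
                   - pairing (\<lambda>x. u x t) (Lambda \<alpha> \<phi>)) (at t within {..0})))"

end

theory Submission
  imports Defs "HOL-Probability.Probability" "HOL-Real_Asymp.Real_Asymp"
begin

text \<open>
  On the Fourier side the equation is \<open>\<partial>\<^sub>t F u = - \<bar>\<xi>\<bar>\<^sup>\<alpha> F u\<close>, so a solution grows exponentially backwards in
  time at every frequency \<open>\<xi> \<noteq> 0\<close>. The decay hypothesis bounds all pairings with a fixed Schwartz
  function uniformly in time, so an ancient solution can have no frequency other than zero. A function
  with spectrum in the origin is a polynomial, and the decay in \<open>x\<close> leaves only zero.

  The proof makes this quantitative with test functions \<open>g\<close>, smooth and compactly supported on the
  frequency side, and the pairing of \<open>u\<close> with \<open>inverse_fourier g\<close>. By \<open>norm_pairing_inverse_fourier_le\<close>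
  this pairing is bounded by the \<open>W\<^bsup>1,1\<^esup>\<close> norm of \<open>g\<close>, because \<open>\<bar>x\<bar> powr (- a) / (1 + \<bar>x\<bar>)\<close> is integrable. By
  Fourier inversion (\<open>fourier_inverse_fourier\<close>) the operator \<open>\<Lambda>\<^sup>\<alpha>\<close> multiplies \<open>g\<close> by the symbol.

  For \<open>g\<close> vanishing near the origin, \<open>pairing_eq_0_away_from_0\<close> shows that the pairing is zero: the
  symbol differs from a suitable constant \<open>R > 0\<close> by at most \<open>\<theta> R\<close> with \<open>\<theta> < 1\<close> on the support of \<open>g\<close>, and
  boundedness at \<open>t = -\<infinity>\<close> allows the equation to be solved for the pairing at the price of one more
  factor \<open>\<theta>\<close> any number of times (\<open>backward_bounded_ode_bound\<close>).

  For general \<open>g\<close> the part of \<open>g\<close> near the origin is cut off; its pairing tends to zero as the cut-off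
  shrinks (\<open>pairing_shrinking_cutoff_tendsto_0\<close>). This takes the place of the statement about
  polynomials. So all pairings vanish, and \<open>AE_zero_if_pairing_zero\<close> turns this into \<open>u = 0\<close>.
\<close>

section \<open>Smooth functions of a real variable\<close>

text \<open>
  Smoothness is reached through \<open>n\<close>-fold differentiability because the closure properties then
  follow by induction on \<open>n\<close>. The set \<open>S\<close> is there for \<open>x powr b\<close>, which is smooth on the
  positive half-line only.
\<close>
primrec times_differentiable :: "nat \<Rightarrow> real set \<Rightarrow> (real \<Rightarrow> 'a::real_normed_vector) \<Rightarrow> bool" where
  "times_differentiable 0 S f \<longleftrightarrow> True"
| "times_differentiable (Suc n) S f \<longleftrightarrow>
     (\<exists>f'. (\<forall>x\<in>S. (f has_vector_derivative f' x) (at x)) \<and> times_differentiable n S f')"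

lemma times_differentiable_SucI:
  assumes "\<And>x. x \<in> S \<Longrightarrow> (f has_vector_derivative f' x) (at x)" "times_differentiable n S f'"
  shows "times_differentiable (Suc n) S f"
  using assms by auto

lemma times_differentiable_pred: "times_differentiable (Suc n) S f \<Longrightarrow> times_differentiable n S f"
proof (induction n arbitrary: f)
  case (Suc n)
  then show ?case by (metis times_differentiable.simps(2))
qed simp

lemma times_differentiable_const [simp]: "times_differentiable n S (\<lambda>x. c)"
proof (induction n arbitrary: c)
  case (Suc n)
  from Suc.IH[of 0] show ?case by (intro times_differentiable_SucI[where f'="\<lambda>_. 0"]) auto
qed simp

lemma times_differentiable_ident [simp]: "times_differentiable n S (\<lambda>x. x)"
proof (cases n)
  case (Suc k)
  show ?thesis unfolding Suc
    by (intro times_differentiable_SucI[where f'="\<lambda>_. 1"] has_vector_derivative_id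
        times_differentiable_const)
qed simp

lemma times_differentiable_add:
  "times_differentiable n S f \<Longrightarrow> times_differentiable n S g \<Longrightarrow> times_differentiable n S (\<lambda>x. f x + g x)"
proof (induction n arbitrary: f g)
  case (Suc n)
  then obtain f' g' where "\<forall>x\<in>S. (f has_vector_derivative f' x) (at x)" "times_differentiable n S f'"
    "\<forall>x\<in>S. (g has_vector_derivative g' x) (at x)" "times_differentiable n S g'" by auto
  with Suc.IH show ?case
    by (intro times_differentiable_SucI[where f'="\<lambda>x. f' x + g' x"] has_vector_derivative_add) auto
qed simp

lemma times_differentiable_bilinear:
  assumes "bounded_bilinear pr"
  shows "times_differentiable n S f \<Longrightarrow> times_differentiable n S g \<Longrightarrow>
    times_differentiable n S (\<lambda>x. pr (f x) (g x))"
proof (induction n arbitrary: f g)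
  case (Suc n)
  then obtain f' g' where fg: "\<forall>x\<in>S. (f has_vector_derivative f' x) (at x)" "times_differentiable n S f'"
    "\<forall>x\<in>S. (g has_vector_derivative g' x) (at x)" "times_differentiable n S g'" by auto
  have "times_differentiable n S f" "times_differentiable n S g"
    using Suc.prems times_differentiable_pred by blast+
  with fg Suc.IH have "times_differentiable n S (\<lambda>x. pr (f x) (g' x) + pr (f' x) (g x))"
    by (intro times_differentiable_add) auto
  with fg show ?case
    by (intro times_differentiable_SucI[where f'="\<lambda>x. pr (f x) (g' x) + pr (f' x) (g x)"]
          bounded_bilinear.has_vector_derivative[OF assms]) auto
qed simp

lemmas times_differentiable_mult = times_differentiable_bilinear[OF bounded_bilinear_mult]

lemma times_differentiable_power:
  fixes f :: "real \<Rightarrow> 'a::real_normed_field"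
  assumes "times_differentiable n S f"
  shows "times_differentiable n S (\<lambda>x. f x ^ k)"
  by (induction k) (auto intro!: times_differentiable_mult assms)

lemma times_differentiable_compose:
  assumes "g ` S \<subseteq> T" "times_differentiable n T f" "times_differentiable n S g"
  shows "times_differentiable n S (\<lambda>x. f (g x))"
  using assms(2,3)
proof (induction n arbitrary: f)
  case (Suc n)
  then obtain f' g' where fg: "\<forall>x\<in>T. (f has_vector_derivative f' x) (at x)" "times_differentiable n T f'"
    "\<forall>x\<in>S. (g has_vector_derivative g' x) (at x)" "times_differentiable n S g'" by auto
  have "times_differentiable n S g"
    using Suc.prems times_differentiable_pred by blast
  with Suc.IH fg have "times_differentiable n S (\<lambda>x. g' x *\<^sub>R f' (g x))"
    by (intro times_differentiable_bilinear[OF bounded_bilinear_scaleR]) auto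
  with fg assms(1) show ?case
    by (intro times_differentiable_SucI[where f'="\<lambda>x. g' x *\<^sub>R f' (g x)"]
          vector_diff_chain_at[unfolded o_def]) auto
qed simp

lemma times_differentiable_of_real:
  "times_differentiable n S f \<Longrightarrow> times_differentiable n S (\<lambda>x. complex_of_real (f x))"
proof (induction n arbitrary: f)
  case (Suc n)
  then obtain f' where f: "\<forall>x\<in>S. (f has_vector_derivative f' x) (at x)" "times_differentiable n S f'"
    by auto
  with Suc.IH show ?case
    by (intro times_differentiable_SucI[where f'="\<lambda>x. complex_of_real (f' x)"]
          has_vector_derivative_of_real) (auto simp: has_real_derivative_iff_has_vector_derivative)
qed simp

lemma times_differentiable_powr: "times_differentiable n {0<..} (\<lambda>x. c * x powr b)"
proof (induction n arbitrary: c b)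
  case (Suc n)
  have "((\<lambda>x. c * x powr b) has_vector_derivative (c * b) * x powr (b - 1)) (at x)" if "x > 0" for x
    unfolding has_real_derivative_iff_has_vector_derivative[symmetric]
    using that by (auto intro!: derivative_eq_intros)
  with Suc.IH[of "c * b" "b - 1"] show ?case
    by (intro times_differentiable_SucI[where f'="\<lambda>x. (c * b) * x powr (b - 1)"]) auto
qed simp

definition smooth :: "(real \<Rightarrow> 'a::real_normed_vector) \<Rightarrow> bool" where
  "smooth f \<longleftrightarrow> (\<forall>n. times_differentiable n UNIV f)"

named_theorems smooth_intros

lemma smooth_const [smooth_intros]: "smooth (\<lambda>x. c)"
  and smooth_ident [smooth_intros]: "smooth (\<lambda>x. x)"
  by (simp_all add: smooth_def)

lemma smooth_add [smooth_intros]: "smooth f \<Longrightarrow> smooth g \<Longrightarrow> smooth (\<lambda>x. f x + g x)"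
  by (simp add: smooth_def times_differentiable_add)

lemma smooth_mult [smooth_intros]:
  fixes f :: "real \<Rightarrow> 'a::real_normed_algebra"
  shows "smooth f \<Longrightarrow> smooth g \<Longrightarrow> smooth (\<lambda>x. f x * g x)"
  by (simp add: smooth_def times_differentiable_mult)

lemma smooth_power [smooth_intros]:
  fixes f :: "real \<Rightarrow> 'a::real_normed_field"
  shows "smooth f \<Longrightarrow> smooth (\<lambda>x. f x ^ k)"
  by (simp add: smooth_def times_differentiable_power)

lemma smooth_of_real [smooth_intros]: "smooth f \<Longrightarrow> smooth (\<lambda>x. complex_of_real (f x))"
  by (simp add: smooth_def times_differentiable_of_real)

lemma smooth_minus [smooth_intros]:
  fixes f :: "real \<Rightarrow> 'a::real_normed_field"
  shows "smooth f \<Longrightarrow> smooth (\<lambda>x. - f x)"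
  using smooth_mult[OF smooth_const[of "-1"], of f] by simp

lemma smooth_diff [smooth_intros]:
  fixes f :: "real \<Rightarrow> 'a::real_normed_field"
  shows "smooth f \<Longrightarrow> smooth g \<Longrightarrow> smooth (\<lambda>x. f x - g x)"
  using smooth_add[OF _ smooth_minus, of f g] by simp

lemma smooth_compose: "smooth f \<Longrightarrow> smooth g \<Longrightarrow> smooth (\<lambda>x. f (g x))"
  unfolding smooth_def using times_differentiable_compose[of g UNIV UNIV _ f] by blast

lemma smooth_powr:
  fixes f :: "real \<Rightarrow> real"
  assumes "\<And>x. f x > 0" "smooth f"
  shows "smooth (\<lambda>x. f x powr b)"
proof -
  have "times_differentiable n UNIV (\<lambda>x. 1 * f x powr b)" for n
  proof (rule times_differentiable_compose[where f="\<lambda>y. 1 * y powr b" and g=f])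
    show "f ` UNIV \<subseteq> {0<..}" using assms(1) by blast
    show "times_differentiable n {0<..} (\<lambda>y. 1 * y powr b)" by (rule times_differentiable_powr)
    show "times_differentiable n UNIV f" using assms(2) unfolding smooth_def by blast
  qed
  then show ?thesis by (simp add: smooth_def)
qed

lemma smooth_has_derivative:
  assumes "smooth f"
  shows "(f has_vector_derivative vector_derivative f (at x)) (at x)"
    and "smooth (\<lambda>x. vector_derivative f (at x))"
proof -
  have *: "\<exists>f'. (\<forall>x. (f has_vector_derivative f' x) (at x)) \<and> times_differentiable n UNIV f'" for n
    using assms unfolding smooth_def by (auto dest: spec[of _ "Suc n"])
  from *[of 0] show "(f has_vector_derivative vector_derivative f (at x)) (at x)"
    by (metis vector_derivative_at)
  have "times_differentiable n UNIV (\<lambda>x. vector_derivative f (at x))" for n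
  proof -
    from *[of n] obtain f' where f': "\<forall>x. (f has_vector_derivative f' x) (at x)" "times_differentiable n UNIV f'"
      by auto
    then have "(\<lambda>x. vector_derivative f (at x)) = f'"
      by (auto intro!: vector_derivative_at)
    with f' show ?thesis by simp
  qed
  then show "smooth (\<lambda>x. vector_derivative f (at x))" by (simp add: smooth_def)
qed

lemma smooth_continuous_on: "smooth f \<Longrightarrow> continuous_on S f"
  using has_vector_derivative_continuous[OF smooth_has_derivative(1)]
  by (intro continuous_at_imp_continuous_on) blast

lemma smooth_measurable:
  fixes f :: "real \<Rightarrow> 'a::{real_normed_vector, second_countable_topology}"
  shows "smooth f \<Longrightarrow> f \<in> borel_measurable borel"
  by (intro borel_measurable_continuous_onI smooth_continuous_on)

section \<open>Bump functions\<close>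

text \<open>
  The powers of \<open>1 / x\<close> are carried along because differentiation maps this family into its
  own linear span, so that smoothness of all its members is one induction.
\<close>
definition half_bump :: "nat \<Rightarrow> real \<Rightarrow> real" where
  "half_bump k x = (if x > 0 then exp (- 1 / x) / x ^ k else 0)"

lemma half_bump_quotient_tendsto_0: "((\<lambda>h. exp (- 1 / h) / h ^ k) \<longlongrightarrow> 0) (at_right (0::real))"
  by real_asymp

lemma has_derivative_half_bump:
  "(half_bump k has_real_derivative half_bump (k + 2) x - real k * half_bump (k + 1) x) (at x)"
proof (cases x "0::real" rule: linorder_cases)
  case less
  have "((\<lambda>x. 0) has_real_derivative half_bump (k + 2) x - real k * half_bump (k + 1) x) (at x)"
    using less by (simp add: half_bump_def)
  from has_field_derivative_transform_within_open[OF this, of "{..<0}" "half_bump k"] less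
  show ?thesis by (auto simp: half_bump_def)
next
  case equal
  have "((\<lambda>h. half_bump k h / h) \<longlongrightarrow> 0) (at_right 0)"
    using half_bump_quotient_tendsto_0[of "Suc k"]
    by (rule Lim_transform_eventually)
       (auto simp: half_bump_def eventually_at_filter)
  moreover have "((\<lambda>h. half_bump k h / h) \<longlongrightarrow> 0) (at_left 0)"
    by (rule Lim_transform_eventually[OF tendsto_const])
       (auto simp: half_bump_def eventually_at_filter)
  ultimately show ?thesis unfolding equal
    by (simp add: has_field_derivative_iff half_bump_def[of _ 0] filterlim_at_split)
next
  case greater
  have "((\<lambda>x. exp (- 1 / x) / x ^ k) has_real_derivative half_bump (k + 2) x - real k * half_bump (k + 1) x) (at x)"
  proof -
    have "((\<lambda>x. x ^ k) has_real_derivative real k * x ^ k / x) (at x)"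
      using greater DERIV_pow[of k x] by (cases k) auto
    moreover have "((\<lambda>x. exp (- 1 / x)) has_real_derivative exp (- 1 / x) / x\<^sup>2) (at x)"
      using greater by (auto intro!: derivative_eq_intros simp: power2_eq_square)
    ultimately have "((\<lambda>x. exp (- 1 / x) / x ^ k) has_real_derivative
        (exp (- 1 / x) / x\<^sup>2 * x ^ k - exp (- 1 / x) * (real k * x ^ k / x)) / (x ^ k * x ^ k)) (at x)"
      using greater by (intro DERIV_divide) auto
    moreover have "(exp (- 1 / x) / x\<^sup>2 * x ^ k - exp (- 1 / x) * (real k * x ^ k / x)) / (x ^ k * x ^ k)
        = half_bump (k + 2) x - real k * half_bump (k + 1) x"
      using greater by (simp add: half_bump_def field_simps power2_eq_square)
    ultimately show ?thesis by simp
  qed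
  from has_field_derivative_transform_within_open[OF this, of "{0<..}" "half_bump k"] greater
  show ?thesis by (auto simp: half_bump_def)
qed

lemma smooth_half_bump: "smooth (half_bump k)"
proof -
  have "times_differentiable n UNIV (half_bump k)" for n
  proof (induction n arbitrary: k)
    case (Suc n)
    have "times_differentiable n UNIV (\<lambda>x. half_bump (k + 2) x + (- real k) * half_bump (k + 1) x)"
      by (intro times_differentiable_add times_differentiable_mult times_differentiable_const Suc.IH)
    with has_derivative_half_bump[of k] show ?case
      by (intro times_differentiable_SucI[where f'="\<lambda>x. half_bump (k + 2) x + (- real k) * half_bump (k + 1) x"])
         (auto simp: has_real_derivative_iff_has_vector_derivative)
  qed simp
  then show ?thesis by (simp add: smooth_def)
qed

definition bump :: "real \<Rightarrow> real" where
  "bump x = half_bump 0 (1 - x\<^sup>2)"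

lemma smooth_bump: "smooth bump"
proof -
  have "smooth (\<lambda>x. half_bump 0 (1 - x\<^sup>2))"
    by (rule smooth_compose[OF smooth_half_bump]) (intro smooth_intros)
  then show ?thesis by (simp add: bump_def[abs_def])
qed

lemma bump_nonneg: "bump x \<ge> 0"
  by (simp add: bump_def half_bump_def)

lemma bump_pos_iff: "bump x > 0 \<longleftrightarrow> \<bar>x\<bar> < 1"
  by (simp add: bump_def half_bump_def abs_square_less_1)

lemma bump_eq_0_iff: "bump x = 0 \<longleftrightarrow> \<bar>x\<bar> \<ge> 1"
  using bump_nonneg[of x] bump_pos_iff[of x] by linarith

text \<open>
  Near the origin \<open>bump\<close> exceeds half its maximum, where \<open>half_bump\<close> of a negative number
  vanishes; where \<open>bump\<close> is zero, the quotient is one. So this is a cut-off function built without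
  integrating a bump.
\<close>
definition plateau :: "real \<Rightarrow> real" where
  "plateau x = 1 - half_bump 0 (bump 0 / 2 - bump x) / half_bump 0 (bump 0 / 2)"

lemma smooth_plateau: "smooth plateau"
proof -
  have "smooth (\<lambda>x. half_bump 0 (bump 0 / 2 - bump x))"
    by (rule smooth_compose[OF smooth_half_bump]) (intro smooth_intros smooth_bump)
  then have "smooth (\<lambda>x. 1 - half_bump 0 (bump 0 / 2 - bump x) * (1 / half_bump 0 (bump 0 / 2)))"
    by (intro smooth_intros)
  then show ?thesis by (simp add: plateau_def[abs_def])
qed

lemma plateau_eq_0: "\<bar>x\<bar> \<ge> 1 \<Longrightarrow> plateau x = 0"
  using bump_eq_0_iff[of x] bump_pos_iff[of 0] by (simp add: plateau_def half_bump_def)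

lemma plateau_eq_1: "\<exists>d>0. \<forall>x. \<bar>x\<bar> < d \<longrightarrow> plateau x = 1"
proof -
  have "isCont bump 0"
    using smooth_continuous_on[OF smooth_bump, of UNIV] by (simp add: continuous_on_eq_continuous_at)
  moreover have "bump 0 / 2 > 0" using bump_pos_iff[of 0] by simp
  ultimately have "\<exists>d>0. \<forall>x. dist x 0 < d \<longrightarrow> dist (bump x) (bump 0) < bump 0 / 2"
    unfolding continuous_at_eps_delta by blast
  then obtain d where d: "d > 0" "\<And>x. \<bar>x\<bar> < d \<Longrightarrow> \<bar>bump x - bump 0\<bar> < bump 0 / 2"
    by (auto simp: dist_real_def)
  have "plateau x = 1" if "\<bar>x\<bar> < d" for x
    using d(2)[OF that] by (auto simp: plateau_def half_bump_def)
  with d(1) show ?thesis by blast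
qed

section \<open>Inverse Fourier transforms of test functions\<close>

lemma has_vector_derivative_cis_mult:
  "((\<lambda>\<xi>. c * cis (x * \<xi>)) has_vector_derivative (c * \<i> * of_real x) * cis (x * \<xi>)) (at \<xi>)"
  unfolding has_vector_derivative_def
  by (auto intro!: derivative_eq_intros simp: scaleR_conv_of_real fun_eq_iff)

lemma smooth_cis [smooth_intros]: "smooth (\<lambda>\<xi>. cis (x * \<xi>))"
proof -
  have "times_differentiable n UNIV (\<lambda>\<xi>. c * cis (x * \<xi>))" for n c
  proof (induction n arbitrary: c)
    case (Suc n)
    show ?case by (rule times_differentiable_SucI[OF has_vector_derivative_cis_mult Suc.IH])
  qed simp
  from this[of _ 1] show ?thesis by (simp add: smooth_def)
qed

text \<open>
  The test functions live on the frequency side; the Schwartz functions that are paired with a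
  solution are their inverse Fourier transforms.
\<close>
definition test_function :: "(real \<Rightarrow> complex) \<Rightarrow> bool" where
  "test_function g \<longleftrightarrow> smooth g \<and> (\<exists>r. \<forall>\<xi>. \<bar>\<xi>\<bar> > r \<longrightarrow> g \<xi> = 0)"

abbreviation ddx :: "(real \<Rightarrow> complex) \<Rightarrow> real \<Rightarrow> complex" where
  "ddx g \<equiv> (\<lambda>\<xi>. vector_derivative g (at \<xi>))"

lemma test_function_smooth: "test_function g \<Longrightarrow> smooth g"
  by (simp add: test_function_def)

lemma ddx_eq_0_on_open:
  assumes "open S" "\<And>\<xi>. \<xi> \<in> S \<Longrightarrow> g \<xi> = 0" "\<xi> \<in> S"
  shows "ddx g \<xi> = 0"
proof (rule vector_derivative_at)
  show "(g has_vector_derivative 0) (at \<xi>)"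
    by (rule has_vector_derivative_transform_within_open[OF has_vector_derivative_const assms(1,3)])
       (simp add: assms)
qed

lemma ddx_eq_0:
  assumes "\<And>\<xi>. \<bar>\<xi>\<bar> > r \<Longrightarrow> g \<xi> = 0" "\<bar>\<xi>\<bar> > r"
  shows "ddx g \<xi> = 0"
proof (rule ddx_eq_0_on_open)
  show "open {\<xi>::real. \<bar>\<xi>\<bar> > r}" by (intro open_Collect_less continuous_intros)
qed (use assms in auto)

lemma test_function_ddx: "test_function g \<Longrightarrow> test_function (ddx g)"
  unfolding test_function_def using smooth_has_derivative(2)[of g] ddx_eq_0[of _ g] by blast

lemma test_function_mult:
  assumes "smooth f" "test_function g"
  shows "test_function (\<lambda>\<xi>. f \<xi> * g \<xi>)"
proof -
  obtain r where "\<And>\<xi>. \<bar>\<xi>\<bar> > r \<Longrightarrow> g \<xi> = 0"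
    using assms unfolding test_function_def by blast
  with assms show ?thesis unfolding test_function_def
    by (intro conjI exI[of _ r] smooth_mult) auto
qed

lemma test_function_bound:
  assumes "test_function g"
  obtains B where "\<And>\<xi>. norm (g \<xi>) \<le> B"
proof -
  obtain r where r: "\<And>\<xi>. \<bar>\<xi>\<bar> > r \<Longrightarrow> g \<xi> = 0"
    using assms unfolding test_function_def by blast
  have "compact (g ` {-r..r})"
    using assms by (intro compact_continuous_image smooth_continuous_on test_function_smooth) auto
  then have "bounded (g ` {-r..r})" by (rule compact_imp_bounded)
  then obtain B where B: "B > 0" "\<And>\<xi>. \<xi> \<in> {-r..r} \<Longrightarrow> norm (g \<xi>) \<le> B"
    unfolding bounded_pos by auto
  have "norm (g \<xi>) \<le> B" for \<xi>
    using B(1) B(2)[of \<xi>] r[of \<xi>] by (cases "\<bar>\<xi>\<bar> > r") (auto simp: abs_le_iff not_less)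
  then show ?thesis by (rule that)
qed

lemma test_function_integrable:
  assumes "test_function g"
  shows "integrable lborel g"
proof -
  obtain r where r: "\<And>\<xi>. \<bar>\<xi>\<bar> > r \<Longrightarrow> g \<xi> = 0"
    using assms unfolding test_function_def by blast
  have "integrable lborel (\<lambda>\<xi>. indicator {-r..r} \<xi> *\<^sub>R g \<xi>)"
    using assms by (intro borel_integrable_compact smooth_continuous_on test_function_smooth) auto
  also have "(\<lambda>\<xi>. indicator {-r..r} \<xi> *\<^sub>R g \<xi>) = g"
    using r by (force simp: indicator_def abs_le_iff not_less)
  finally show ?thesis .
qed

lemma test_function_measurable [measurable_dest]: "test_function g \<Longrightarrow> g \<in> borel_measurable borel"
  by (intro smooth_measurable test_function_smooth)

text \<open>
  Applied to a product, this is integration by parts without boundary terms.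
\<close>
lemma integral_ddx:
  assumes "test_function g"
  shows "(LINT \<xi>|lborel. ddx g \<xi>) = 0"
proof -
  obtain r where r: "\<And>\<xi>. \<bar>\<xi>\<bar> > r \<Longrightarrow> g \<xi> = 0"
    using assms unfolding test_function_def by blast
  define s where "s = \<bar>r\<bar> + 1"
  have "(LINT \<xi>|lborel. indicator {-s..s} \<xi> *\<^sub>R ddx g \<xi>) = g s - g (-s)"
  proof (rule integral_FTC_atLeastAtMost)
    show "- s \<le> s" by (simp add: s_def)
    show "(g has_vector_derivative ddx g \<xi>) (at \<xi> within {-s..s})" for \<xi>
      using smooth_has_derivative(1)[OF test_function_smooth[OF assms]]
      by (rule has_vector_derivative_at_within)
    show "continuous_on {-s..s} (ddx g)"
      by (intro smooth_continuous_on test_function_smooth test_function_ddx assms)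
  qed
  also have "\<dots> = 0" using r[of s] r[of "-s"] by (simp add: s_def)
  also have "(\<lambda>\<xi>. indicator {-s..s} \<xi> *\<^sub>R ddx g \<xi>) = ddx g"
    using ddx_eq_0[of s g] r by (force simp: indicator_def s_def)
  finally show ?thesis by simp
qed

lemma test_function_cis_mult: "test_function g \<Longrightarrow> test_function (\<lambda>\<xi>. cis (x * \<xi>) * g \<xi>)"
  by (intro test_function_mult smooth_intros)

lemma inverse_fourier_ddx:
  assumes "test_function g"
  shows "inverse_fourier (ddx g) x = - \<i> * of_real x * inverse_fourier g x"
proof -
  let ?h = "\<lambda>\<xi>. cis (x * \<xi>) * g \<xi>"
  have h: "ddx ?h = (\<lambda>\<xi>. \<i> * of_real x * ?h \<xi> + cis (x * \<xi>) * ddx g \<xi>)"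
  proof
    fix \<xi>
    have "(?h has_vector_derivative cis (x * \<xi>) * ddx g \<xi> + (1 * \<i> * of_real x) * cis (x * \<xi>) * g \<xi>) (at \<xi>)"
      using has_vector_derivative_cis_mult[of 1 x \<xi>]
      by (intro has_vector_derivative_mult smooth_has_derivative test_function_smooth assms) simp
    then show "ddx ?h \<xi> = \<i> * of_real x * ?h \<xi> + cis (x * \<xi>) * ddx g \<xi>"
      by (auto simp: algebra_simps dest: vector_derivative_at)
  qed
  have "0 = (LINT \<xi>|lborel. \<i> * of_real x * ?h \<xi> + cis (x * \<xi>) * ddx g \<xi>)"
    using integral_ddx[OF test_function_cis_mult[OF assms], of x] unfolding h by simp
  also have "\<dots> = \<i> * of_real x * (LINT \<xi>|lborel. ?h \<xi>) + (LINT \<xi>|lborel. cis (x * \<xi>) * ddx g \<xi>)"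
    by (subst Bochner_Integration.integral_add)
       (auto intro!: test_function_integrable test_function_mult smooth_intros test_function_ddx assms)
  finally show ?thesis
    unfolding inverse_fourier_def by (simp add: field_simps eq_neg_iff_add_eq_0 add.commute)
qed

lemma inverse_fourier_norm_le:
  assumes "integrable lborel g"
  shows "norm (inverse_fourier g x) \<le> (LINT \<xi>|lborel. norm (g \<xi>)) / (2 * pi)"
proof -
  have "norm (LINT \<xi>|lborel. cis (x * \<xi>) * g \<xi>) \<le> (LINT \<xi>|lborel. norm (cis (x * \<xi>) * g \<xi>))"
    by (rule integral_norm_bound)
  then show ?thesis
    by (simp add: inverse_fourier_def norm_mult norm_divide divide_right_mono)
qed

text \<open>
  Each factor \<open>x\<close> is traded for one derivative of \<open>g\<close>, which is again a test function.
\<close>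
lemma inverse_fourier_power_bound:
  assumes "test_function g"
  shows "\<exists>B. \<forall>x. \<bar>x\<bar> ^ k * norm (inverse_fourier g x) \<le> B"
  using assms
proof (induction k arbitrary: g)
  case 0
  then show ?case
    using inverse_fourier_norm_le[OF test_function_integrable] by auto
next
  case (Suc k)
  then have "\<exists>B. \<forall>x. \<bar>x\<bar> ^ k * norm (inverse_fourier (ddx g) x) \<le> B"
    by (simp add: test_function_ddx)
  with Suc.prems show ?case
    by (simp add: inverse_fourier_ddx norm_mult mult_ac)
qed

lemma cis_taylor_bound: "norm (cis y - cis x - \<i> * of_real (y - x) * cis x) \<le> (y - x)\<^sup>2 / 2"
proof -
  have "norm (cis y - cis x - \<i> * of_real (y - x) * cis x)
      = norm (cis x * (cis (y - x) - (1 + \<i> * of_real (y - x))))"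
    by (simp add: algebra_simps cis_mult)
  also have "\<dots> = norm (cis (y - x) - (1 + \<i> * of_real (y - x)))"
    by (simp add: norm_mult)
  also have "\<dots> \<le> (y - x)\<^sup>2 / 2"
    using iexp_approx1[of "y - x" 1] by (simp add: cis_conv_exp eval_nat_numeral)
  finally show ?thesis .
qed

text \<open>
  Differentiation under the integral sign: the second-order remainder of \<open>cis\<close> is bounded by
  \<open>\<xi>\<^sup>2 (y - x)\<^sup>2 / 2\<close>, and \<open>\<xi>\<^sup>2 g \<xi>\<close> is integrable.
\<close>
lemma has_vector_derivative_inverse_fourier:
  assumes "test_function g"
  shows "(inverse_fourier g has_vector_derivative inverse_fourier (\<lambda>\<xi>. \<i> * of_real \<xi> * g \<xi>) x) (at x)"
proof -
  let ?g1 = "\<lambda>\<xi>. \<i> * of_real \<xi> * g \<xi>"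
  let ?g2 = "\<lambda>\<xi>. of_real \<xi> ^ 2 * g \<xi>"
  have tf: "test_function ?g1" "test_function ?g2"
    by (auto intro!: test_function_mult smooth_intros assms)
  define K where "K = (LINT \<xi>|lborel. norm (?g2 \<xi>) / 2) / (2 * pi)"
  have bound: "norm (inverse_fourier g y - inverse_fourier g x - (y - x) *\<^sub>R inverse_fourier ?g1 x) \<le> K * (y - x)\<^sup>2" for y
  proof -
    let ?e = "\<lambda>\<xi>. (cis (y * \<xi>) - cis (x * \<xi>) - \<i> * of_real (y * \<xi> - x * \<xi>) * cis (x * \<xi>)) * g \<xi>"
    have i: "integrable lborel (\<lambda>\<xi>. cis (z * \<xi>) * g \<xi>)" "integrable lborel (\<lambda>\<xi>. cis (z * \<xi>) * ?g1 \<xi>)" for z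
      by (auto intro!: test_function_integrable test_function_cis_mult tf assms)
    have "inverse_fourier g y - inverse_fourier g x - (y - x) *\<^sub>R inverse_fourier ?g1 x
      = ((LINT \<xi>|lborel. cis (y * \<xi>) * g \<xi>) - (LINT \<xi>|lborel. cis (x * \<xi>) * g \<xi>)
          - of_real (y - x) * (LINT \<xi>|lborel. cis (x * \<xi>) * ?g1 \<xi>)) / (2 * pi)"
      unfolding inverse_fourier_def by (simp add: field_simps scaleR_conv_of_real)
    also have "\<dots> = (LINT \<xi>|lborel. cis (y * \<xi>) * g \<xi> - cis (x * \<xi>) * g \<xi>
          - of_real (y - x) * (cis (x * \<xi>) * ?g1 \<xi>)) / (2 * pi)"
      using i by (simp only: Bochner_Integration.integral_diff integral_mult_right_zero
          Bochner_Integration.integrable_diff integrable_mult_right)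
    also have "\<dots> = (LINT \<xi>|lborel. ?e \<xi>) / (2 * pi)"
      by (simp add: algebra_simps)
    finally have eq: "inverse_fourier g y - inverse_fourier g x - (y - x) *\<^sub>R inverse_fourier ?g1 x
      = (LINT \<xi>|lborel. ?e \<xi>) / (2 * pi)" .
    have e_le: "norm (?e \<xi>) \<le> (y - x)\<^sup>2 * (norm (?g2 \<xi>) / 2)" for \<xi>
    proof -
      have "norm (?e \<xi>) \<le> (y * \<xi> - x * \<xi>)\<^sup>2 / 2 * norm (g \<xi>)"
        unfolding norm_mult by (intro mult_right_mono cis_taylor_bound) auto
      also have "\<dots> = (y - x)\<^sup>2 * (norm (?g2 \<xi>) / 2)"
        by (simp add: norm_mult norm_power flip: left_diff_distrib power_mult_distrib)
      finally show ?thesis .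
    qed
    define I where "I = (LINT \<xi>|lborel. ?e \<xi>)"
    define J where "J = (LINT \<xi>|lborel. norm (?g2 \<xi>) / 2)"
    have "norm I \<le> (LINT \<xi>|lborel. (y - x)\<^sup>2 * (norm (?g2 \<xi>) / 2))"
      unfolding I_def using e_le assms
      by (intro Bochner_Integration.integral_norm_bound_integral)
         (auto intro!: test_function_integrable test_function_mult smooth_intros integrable_norm
            integrable_divide_zero integrable_mult_right tf)
    also have "\<dots> = (y - x)\<^sup>2 * J" unfolding J_def by (rule integral_mult_right_zero)
    finally have "norm I / (2 * pi) \<le> (y - x)\<^sup>2 * J / (2 * pi)"
      by (rule divide_right_mono) simp
    then show ?thesis unfolding eq K_def I_def[symmetric] J_def[symmetric]
      by (simp add: norm_divide norm_mult mult.commute)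
  qed
  show ?thesis
    unfolding has_vector_derivative_def
  proof (rule has_derivativeI_sandwich[where e=1 and H="\<lambda>y. K * \<bar>y - x\<bar>"])
    show "bounded_linear (\<lambda>h. h *\<^sub>R inverse_fourier ?g1 x)" by (rule bounded_linear_scaleR_left)
    show "((\<lambda>y. K * \<bar>y - x\<bar>) \<longlongrightarrow> 0) (at x)"
      by (rule tendsto_eq_intros | simp)+
    fix y assume "y \<noteq> x"
    then show "norm ((inverse_fourier g y - inverse_fourier g x) - (y - x) *\<^sub>R inverse_fourier ?g1 x) / norm (y - x)
        \<le> K * \<bar>y - x\<bar>"
      using bound[of y] by (simp add: divide_le_eq power2_eq_square mult_ac)
  qed simp
qed

lemma schwartz_inverse_fourier:
  assumes "test_function g"
  shows "schwartz (inverse_fourier g)"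
proof -
  let ?g = "\<lambda>m \<xi>. (\<i> * of_real \<xi>) ^ m * g \<xi>"
  have tf: "test_function (?g m)" for m
    by (auto intro!: test_function_mult smooth_intros assms)
  show ?thesis
    unfolding schwartz_def
  proof (intro exI[of _ "\<lambda>m. inverse_fourier (?g m)"] conjI allI)
  show "inverse_fourier (?g 0) = inverse_fourier g" by simp
  show "(inverse_fourier (?g m) has_vector_derivative inverse_fourier (?g (Suc m)) x) (at x)" for m x
    using has_vector_derivative_inverse_fourier[OF tf[of m], of x] by (simp add: mult_ac)
  show "\<exists>B. \<forall>x. \<bar>x\<bar> ^ k * norm (inverse_fourier (?g m) x) \<le> B" for k m
    by (rule inverse_fourier_power_bound[OF tf])
  qed
qed

lemma inverse_fourier_continuous: "test_function g \<Longrightarrow> continuous_on S (inverse_fourier g)"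
  using has_vector_derivative_continuous[OF has_vector_derivative_inverse_fourier]
  by (intro continuous_at_imp_continuous_on) blast

lemma inverse_fourier_measurable [measurable_dest]:
  "test_function g \<Longrightarrow> inverse_fourier g \<in> borel_measurable borel"
  by (intro borel_measurable_continuous_onI inverse_fourier_continuous)

text \<open>
  The norm of the Sobolev space \<open>W\<^bsup>1,1\<^esup>\<close>. One derivative suffices for all estimates, since a decay of
  order \<open>\<bar>x\<bar>\<^bsup>-1\<^esup>\<close> makes the product with \<open>\<bar>x\<bar> powr (- a)\<close> integrable at infinity.
\<close>
definition w1_norm :: "(real \<Rightarrow> complex) \<Rightarrow> real" where
  "w1_norm g = (LINT \<xi>|lborel. norm (g \<xi>)) + (LINT \<xi>|lborel. norm (ddx g \<xi>))"

lemma inverse_fourier_decay: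
  assumes "test_function g"
  shows "norm (inverse_fourier g x) \<le> w1_norm g / (1 + \<bar>x\<bar>)"
proof -
  have "norm (inverse_fourier g x) \<le> (LINT \<xi>|lborel. norm (g \<xi>)) / (2 * pi)"
    using assms by (intro inverse_fourier_norm_le test_function_integrable)
  moreover have "\<bar>x\<bar> * norm (inverse_fourier g x) \<le> (LINT \<xi>|lborel. norm (ddx g \<xi>)) / (2 * pi)"
    using inverse_fourier_norm_le[OF test_function_integrable[OF test_function_ddx[OF assms]], of x]
    by (simp add: inverse_fourier_ddx[OF assms] norm_mult)
  ultimately have "(1 + \<bar>x\<bar>) * norm (inverse_fourier g x) \<le> w1_norm g / (2 * pi)"
    by (simp add: w1_norm_def algebra_simps add_divide_distrib)
  also have "\<dots> \<le> w1_norm g / 1"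
    using pi_ge_two by (intro divide_left_mono) (auto simp: w1_norm_def intro!: add_nonneg_nonneg Bochner_Integration.integral_nonneg)
  finally show ?thesis by (simp add: field_simps)
qed

lemma inverse_fourier_add:
  assumes "test_function f" "test_function g"
  shows "inverse_fourier (\<lambda>\<xi>. f \<xi> + g \<xi>) x = inverse_fourier f x + inverse_fourier g x"
proof -
  have "(LINT \<xi>|lborel. cis (x * \<xi>) * (f \<xi> + g \<xi>)) = (LINT \<xi>|lborel. cis (x * \<xi>) * f \<xi>) + (LINT \<xi>|lborel. cis (x * \<xi>) * g \<xi>)"
    unfolding distrib_left
    by (intro Bochner_Integration.integral_add test_function_integrable test_function_cis_mult assms)
  then show ?thesis by (simp add: inverse_fourier_def add_divide_distrib)
qed

lemma inverse_fourier_cmult: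
  "inverse_fourier (\<lambda>\<xi>. c * g \<xi>) x = c * inverse_fourier g x"
proof -
  have "(LINT \<xi>|lborel. cis (x * \<xi>) * (c * g \<xi>)) = (LINT \<xi>|lborel. c * (cis (x * \<xi>) * g \<xi>))"
    by (simp add: mult_ac)
  then show ?thesis by (simp add: inverse_fourier_def)
qed

section \<open>Fourier inversion\<close>

lemma fourier_gaussian:
  "(LINT z|lborel. cis (t * z) * of_real (std_normal_density z)) = of_real (exp (- t\<^sup>2 / 2))"
proof -
  have "char std_normal_distribution t = (LINT z|lborel. std_normal_density z *\<^sub>R iexp (t * z))"
    unfolding char_def by (rule integral_density) auto
  also have "\<dots> = (LINT z|lborel. cis (t * z) * of_real (std_normal_density z))"
    by (simp add: cis_conv_exp scaleR_conv_of_real mult.commute)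
  finally show ?thesis by (simp add: char_std_normal_distribution)
qed

lemma integrable_gaussian:
  fixes k :: real
  assumes "k > 0"
  shows "integrable lborel (\<lambda>x. exp (- (x / k)\<^sup>2 / 2))"
proof -
  have "integrable lborel (\<lambda>x. sqrt (2 * pi) * std_normal_density (0 + (1 / k) * x))"
    using assms by (intro integrable_mult_right lborel_integrable_real_affine integrable_normal_density) auto
  then show ?thesis by (simp add: std_normal_density_def)
qed

lemma fourier_dilated_gaussian:
  assumes "k > 0"
  shows "(LINT x|lborel. cis (x * y) * of_real (exp (- (x / k)\<^sup>2 / 2))) = of_real (2 * pi * k * std_normal_density (k * y))"
proof -
  have "(LINT x|lborel. cis (x * y) * of_real (exp (- (x / k)\<^sup>2 / 2)))
      = \<bar>k\<bar> *\<^sub>R (LINT z|lborel. cis ((0 + k * z) * y) * of_real (exp (- ((0 + k * z) / k)\<^sup>2 / 2)))"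
    using assms by (intro lborel_integral_real_affine) auto
  also have "(\<lambda>z. cis ((0 + k * z) * y) * of_real (exp (- ((0 + k * z) / k)\<^sup>2 / 2)))
      = (\<lambda>z. of_real (sqrt (2 * pi)) * (cis ((k * y) * z) * of_real (std_normal_density z)))"
    using assms by (auto simp: std_normal_density_def mult_ac)
  also have "(LINT z|lborel. of_real (sqrt (2 * pi)) * (cis ((k * y) * z) * of_real (std_normal_density z)))
     = of_real (sqrt (2 * pi)) * (of_real (exp (- (k * y)\<^sup>2 / 2)) :: complex)"
    by (simp only: integral_mult_right_zero fourier_gaussian)
  also have "\<bar>k\<bar> *\<^sub>R \<dots> = of_real (k * sqrt (2 * pi) * exp (- (k * y)\<^sup>2 / 2))"
    using assms by (simp add: scaleR_conv_of_real)
  also have "k * sqrt (2 * pi) * exp (- (k * y)\<^sup>2 / 2) = 2 * pi * k * std_normal_density (k * y)"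
    by (simp add: std_normal_density_def field_simps)
  finally show ?thesis .
qed

text \<open>
  Without the Gaussian factor the double integral need not converge absolutely; with it Fubini
  applies, and integrating the Gaussian against the characters over \<open>x\<close> gives a Gaussian of width
  \<open>1 / k\<close> around \<open>\<xi>\<close>.
\<close>
lemma gaussian_regularised_inversion:
  assumes g: "test_function g" and k: "k > 0"
  shows "(LINT x|lborel. cis (- (x * \<xi>)) * of_real (exp (- (x / k)\<^sup>2 / 2)) * inverse_fourier g x)
    = (LINT z|lborel. g (\<xi> + z / k) * of_real (std_normal_density z))"
proof -
  let ?e = "\<lambda>x. of_real (exp (- (x / k)\<^sup>2 / 2)) :: complex"
  let ?f = "\<lambda>x \<eta>. cis (- (x * \<xi>)) * ?e x * (cis (x * \<eta>) * g \<eta>)"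
  note [measurable] = test_function_measurable[OF g] and gi = test_function_integrable[OF g]
  have norm_f: "norm (?f x \<eta>) = exp (- (x / k)\<^sup>2 / 2) * norm (g \<eta>)" for x \<eta>
    by (simp add: norm_mult)
  have "integrable (lborel \<Otimes>\<^sub>M lborel) (case_prod ?f)"
  proof (rule lborel_pair.Fubini_integrable)
    show "case_prod ?f \<in> borel_measurable (lborel \<Otimes>\<^sub>M lborel)"
      unfolding cis_conv_exp by measurable
    show "integrable lborel (\<lambda>x. LINT \<eta>|lborel. norm (case_prod ?f (x, \<eta>)))"
      unfolding prod.case norm_f integral_mult_right_zero
      using integrable_gaussian[OF k] by (rule integrable_mult_left)
    have "integrable lborel (?f x)" for x
      by (intro integrable_mult_right test_function_integrable[OF test_function_cis_mult[OF g]])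
    then show "AE x in lborel. integrable lborel (\<lambda>\<eta>. case_prod ?f (x, \<eta>))"
      by simp
  qed
  then have "(LINT x|lborel. LINT \<eta>|lborel. ?f x \<eta>) = (LINT \<eta>|lborel. LINT x|lborel. ?f x \<eta>)"
    by (rule lborel_pair.Fubini_integral[symmetric])
  also have "(\<lambda>x. LINT \<eta>|lborel. ?f x \<eta>) = (\<lambda>x. (2 * pi) * (cis (- (x * \<xi>)) * ?e x * inverse_fourier g x))"
    unfolding inverse_fourier_def by auto
  also have "(\<lambda>\<eta>. LINT x|lborel. ?f x \<eta>) = (\<lambda>\<eta>. (2 * pi) * (g \<eta> * of_real (k * std_normal_density (k * (\<eta> - \<xi>)))))"
  proof
    fix \<eta>
    have split: "cis (x * (\<eta> - \<xi>)) = cis (- (x * \<xi>)) * cis (x * \<eta>)" for x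
      by (simp add: cis_mult algebra_simps)
    have "(LINT x|lborel. ?f x \<eta>) = (LINT x|lborel. g \<eta> * (cis (x * (\<eta> - \<xi>)) * ?e x))"
      by (simp only: split mult_ac)
    also have "\<dots> = g \<eta> * (LINT x|lborel. cis (x * (\<eta> - \<xi>)) * ?e x)"
      by (rule integral_mult_right_zero)
    finally show "(LINT x|lborel. ?f x \<eta>) = (2 * pi) * (g \<eta> * of_real (k * std_normal_density (k * (\<eta> - \<xi>))))"
      unfolding fourier_dilated_gaussian[OF k] by simp
  qed
  finally have "(LINT x|lborel. cis (- (x * \<xi>)) * ?e x * inverse_fourier g x)
      = (LINT \<eta>|lborel. g \<eta> * of_real (k * std_normal_density (k * (\<eta> - \<xi>))))"
    by (simp only: integral_mult_right_zero mult_cancel_left) simp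
  also have "\<dots> = \<bar>1 / k\<bar> *\<^sub>R (LINT z|lborel. g (\<xi> + 1 / k * z) * of_real (k * std_normal_density (k * (\<xi> + 1 / k * z - \<xi>))))"
    using k by (intro lborel_integral_real_affine) auto
  also have "\<dots> = (LINT z|lborel. \<bar>1 / k\<bar> *\<^sub>R (g (\<xi> + 1 / k * z) * of_real (k * std_normal_density (k * (\<xi> + 1 / k * z - \<xi>)))))"
    by simp
  also have "\<dots> = (LINT z|lborel. g (\<xi> + z / k) * of_real (std_normal_density z))"
    by (rule arg_cong[where f="integral\<^sup>L lborel"]) (use k in \<open>auto simp: scaleR_conv_of_real\<close>)
  finally show ?thesis .
qed

lemma inverse_fourier_integrable:
  assumes g: "test_function g"
  shows "integrable lborel (inverse_fourier g)"
proof -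
  obtain B0 B2 where B: "\<And>x. \<bar>x\<bar> ^ 0 * norm (inverse_fourier g x) \<le> B0" "\<And>x. \<bar>x\<bar> ^ 2 * norm (inverse_fourier g x) \<le> B2"
    using inverse_fourier_power_bound[OF g] by blast
  have "integrable lborel (\<lambda>x. (B0 + B2) * (1 / (1 + x\<^sup>2)))"
    using integrable_inverse_1_plus_square
    by (intro integrable_mult_right) (simp add: set_integrable_def inverse_eq_divide)
  then show ?thesis
  proof (rule Bochner_Integration.integrable_bound)
    show "inverse_fourier g \<in> borel_measurable lborel" using g by measurable
    have "norm (inverse_fourier g x) \<le> (B0 + B2) * (1 / (1 + x\<^sup>2))" for x
    proof -
      have "(1 + x\<^sup>2) * norm (inverse_fourier g x) \<le> B0 + B2"
        using B[of x] by (simp add: distrib_right)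
      moreover have "1 + x\<^sup>2 > 0" by (simp add: add_pos_nonneg)
      ultimately show ?thesis by (simp add: field_simps)
    qed
    then show "AE x in lborel. norm (inverse_fourier g x) \<le> norm ((B0 + B2) * (1 / (1 + x\<^sup>2)))"
      by (intro AE_I2) (metis abs_ge_self order_trans real_norm_def)
  qed
qed

text \<open>
  Both sides of the regularised identity converge by dominated convergence as \<open>k\<close> tends to
  infinity: the left one since the inverse transform is integrable, the right one since \<open>g\<close> is bounded
  and continuous.
\<close>
lemma fourier_inverse_fourier:
  assumes g: "test_function g"
  shows "fourier (inverse_fourier g) = g"
proof
  fix \<xi>
  let ?L = "\<lambda>n. LINT x|lborel. cis (- (x * \<xi>)) * of_real (exp (- (x / Suc n)\<^sup>2 / 2)) * inverse_fourier g x"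
  note [measurable] = test_function_measurable[OF g] inverse_fourier_measurable[OF g]
  have lim: "(\<lambda>n. y / real (Suc n)) \<longlonglongrightarrow> 0" for y
    by real_asymp
  have "?L \<longlonglongrightarrow> fourier (inverse_fourier g) \<xi>"
    unfolding fourier_def
  proof (rule integral_dominated_convergence)
    show "integrable lborel (\<lambda>x. norm (inverse_fourier g x))"
      by (intro integrable_norm inverse_fourier_integrable g)
    show "AE x in lborel. (\<lambda>n. cis (- (x * \<xi>)) * of_real (exp (- (x / Suc n)\<^sup>2 / 2)) * inverse_fourier g x)
        \<longlonglongrightarrow> cis (- (x * \<xi>)) * inverse_fourier g x"
    proof (rule AE_I2)
      fix x :: real
      have "(\<lambda>n. cis (- (x * \<xi>)) * of_real (exp (- (x / Suc n)\<^sup>2 / 2)) * inverse_fourier g x)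
        \<longlonglongrightarrow> cis (- (x * \<xi>)) * of_real (exp (- 0\<^sup>2 / 2)) * inverse_fourier g x"
        by (intro tendsto_intros lim) auto
      then show "(\<lambda>n. cis (- (x * \<xi>)) * of_real (exp (- (x / Suc n)\<^sup>2 / 2)) * inverse_fourier g x)
        \<longlonglongrightarrow> cis (- (x * \<xi>)) * inverse_fourier g x" by simp
    qed
    show "AE x in lborel. norm (cis (- (x * \<xi>)) * of_real (exp (- (x / Suc n)\<^sup>2 / 2)) * inverse_fourier g x)
       \<le> norm (inverse_fourier g x)" for n
      by (auto simp: norm_mult intro!: AE_I2 mult_left_le_one_le)
  qed (unfold cis_conv_exp, measurable)
  moreover have "?L \<longlonglongrightarrow> g \<xi>"
  proof -
    obtain B where B: "\<And>\<xi>. norm (g \<xi>) \<le> B" using test_function_bound[OF g] by blast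
    have "(\<lambda>n. LINT z|lborel. g (\<xi> + z / Suc n) * of_real (std_normal_density z))
        \<longlonglongrightarrow> (LINT z|lborel. g \<xi> * of_real (std_normal_density z))"
    proof (rule integral_dominated_convergence)
      show "integrable lborel (\<lambda>z. B * std_normal_density z)" by simp
      show "AE z in lborel. (\<lambda>n. g (\<xi> + z / Suc n) * of_real (std_normal_density z))
          \<longlonglongrightarrow> g \<xi> * of_real (std_normal_density z)"
      proof (rule AE_I2)
        fix z :: real
        have "(\<lambda>n. \<xi> + z / Suc n) \<longlonglongrightarrow> \<xi> + 0" by (intro tendsto_intros lim)
        moreover have "isCont g (\<xi> + 0)"
          using smooth_continuous_on[OF test_function_smooth[OF g], of UNIV] continuous_on_eq_continuous_at[OF open_UNIV]
          by auto
        ultimately have "(\<lambda>n. g (\<xi> + z / Suc n)) \<longlonglongrightarrow> g (\<xi> + 0)"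
          by (rule isCont_tendsto_compose[rotated])
        then show "(\<lambda>n. g (\<xi> + z / Suc n) * of_real (std_normal_density z)) \<longlonglongrightarrow> g \<xi> * of_real (std_normal_density z)"
          by (intro tendsto_intros) simp
      qed
      show "AE z in lborel. norm (g (\<xi> + z / Suc n) * of_real (std_normal_density z)) \<le> B * std_normal_density z" for n
        using B by (auto simp: norm_mult intro!: AE_I2 mult_right_mono)
    qed measurable
    also have "(LINT z|lborel. g \<xi> * of_real (std_normal_density z)) = g \<xi>"
      using integral_normal_density[of 1 0]
      by (simp only: integral_mult_right_zero integral_complex_of_real) simp
    finally show ?thesis using gaussian_regularised_inversion[OF g, of "Suc _" \<xi>] by simp
  qed
  ultimately show "fourier (inverse_fourier g) \<xi> = g \<xi>" by (rule LIMSEQ_unique)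
qed

lemma Lambda_inverse_fourier:
  assumes "test_function g"
  shows "Lambda \<alpha> (inverse_fourier g) = inverse_fourier (\<lambda>\<xi>. of_real (\<bar>\<xi>\<bar> powr \<alpha>) * g \<xi>)"
  using assms by (simp add: Lambda_def fourier_inverse_fourier)

section \<open>Pairing with functions of power decay\<close>

text \<open>
  The product of the bound \<open>\<bar>x\<bar> powr (- a)\<close> for a solution and the bound \<open>1 / (1 + \<bar>x\<bar>)\<close> for the
  inverse transform of a test function.
\<close>
definition weight :: "real \<Rightarrow> real \<Rightarrow> real" where
  "weight a x = \<bar>x\<bar> powr (- a) / (1 + \<bar>x\<bar>)"

text \<open>
  This is where \<open>0 < a < 1\<close> enters: \<open>a < 1\<close> gives integrability at the origin and \<open>0 < a\<close> at
  infinity.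
\<close>
lemma integrable_weight:
  assumes "0 < a" "a < 1"
  shows "integrable lebesgue (weight a)"
proof -
  \<comment> \<open>\<open>p x + p (- x)\<close> majorises the weight\<close>
  define p :: "real \<Rightarrow> real" where
    "p x = indicator {0..1} x * x powr (- a) + indicator {1..} x * x powr (- a - 1)" for x
  have "(\<lambda>x. x powr (- a)) integrable_on {0..1}"
    using assms by (intro integrable_on_powr_from_0) auto
  then have "(\<lambda>x. x powr (- a)) absolutely_integrable_on {0..1}"
    by (subst absolutely_integrable_on_iff_nonneg) auto
  then have 1: "integrable lborel (\<lambda>x. indicator {0..1} x * x powr (- a))"
    unfolding set_integrable_def by (subst (asm) integrable_completion) auto
  have "(\<lambda>x. x powr (- a - 1)) integrable_on {1..}"
    using has_integral_powr_to_inf[of "- a - 1" 1] assms by auto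
  then have "(\<lambda>x. x powr (- a - 1)) absolutely_integrable_on {1..}"
    by (subst absolutely_integrable_on_iff_nonneg) auto
  then have 2: "integrable lborel (\<lambda>x. indicator {1..} x * x powr (- a - 1))"
    unfolding set_integrable_def by (subst (asm) integrable_completion) auto
  have p: "integrable lborel p"
    unfolding p_def by (intro Bochner_Integration.integrable_add 1 2)
  have p_nonneg: "p x \<ge> 0" for x by (simp add: p_def)
  have pp: "integrable lborel (\<lambda>x. p x + p (0 + (-1) * x))"
    by (intro Bochner_Integration.integrable_add lborel_integrable_real_affine p) auto
  have *: "x powr (- a) / (1 + x) \<le> p x" if "x \<ge> 0" for x
  proof (cases "x \<le> 1")
    case True
    have "x powr (- a) / (1 + x) \<le> x powr (- a) / 1"
      using that by (intro divide_left_mono) auto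
    then show ?thesis using True that by (simp add: p_def indicator_def)
  next
    case False
    have "x powr (- a) / (1 + x) \<le> x powr (- a) / x"
      using False by (intro divide_left_mono) auto
    with False show ?thesis by (simp add: p_def powr_diff)
  qed
  have "\<bar>x\<bar> powr (- a) / (1 + \<bar>x\<bar>) \<le> p x + p (0 + (-1) * x)" for x
    using *[of x] *[of "-x"] p_nonneg[of x] p_nonneg[of "-x"] by (cases "x \<ge> 0") auto
  then have bd: "AE x in lborel. norm (\<bar>x\<bar> powr (- a) / (1 + \<bar>x\<bar>)) \<le> norm (p x + p (0 + (-1) * x))"
    by (intro AE_I2) (simp add: abs_of_nonneg add_nonneg_nonneg p_nonneg)
  have "integrable lborel (\<lambda>x::real. \<bar>x\<bar> powr (- a) / (1 + \<bar>x\<bar>))"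
    using pp _ bd by (rule Bochner_Integration.integrable_bound) measurable
  then show ?thesis
    unfolding weight_def[abs_def] by (subst integrable_completion) auto
qed

definition power_decay :: "real \<Rightarrow> real \<Rightarrow> (real \<Rightarrow> real) \<Rightarrow> bool" where
  "power_decay a C f \<longleftrightarrow> 0 < a \<and> a < 1 \<and> f \<in> borel_measurable lebesgue \<and> (\<forall>x. \<bar>x\<bar> powr a * \<bar>f x\<bar> \<le> C)"

lemma power_decay_product_bound:
  assumes f: "power_decay a C f" and \<phi>: "norm (\<phi> x) \<le> B / (1 + \<bar>x\<bar>)" and "x \<noteq> 0"
  shows "norm (complex_of_real (f x) * \<phi> x) \<le> C * B * weight a x"
proof -
  have pos: "\<bar>x\<bar> powr a > 0" using \<open>x \<noteq> 0\<close> by simp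
  have "\<bar>f x\<bar> \<le> C * \<bar>x\<bar> powr (- a)"
    using f pos unfolding power_decay_def powr_minus_divide by (simp add: field_simps)
  moreover have "0 \<le> C * \<bar>x\<bar> powr (- a)" using calculation abs_ge_zero order_trans by blast
  ultimately have "norm (complex_of_real (f x) * \<phi> x) \<le> (C * \<bar>x\<bar> powr (- a)) * (B / (1 + \<bar>x\<bar>))"
    unfolding norm_mult norm_of_real using \<phi> by (intro mult_mono) auto
  then show ?thesis by (simp add: weight_def mult_ac)
qed

lemma AE_power_decay_product_bound:
  assumes f: "power_decay a C f" and \<phi>: "\<And>x. norm (\<phi> x) \<le> B / (1 + \<bar>x\<bar>)"
  shows "AE x in lebesgue. norm (complex_of_real (f x) * \<phi> x) \<le> C * B * weight a x"
proof -
  have "AE x in lebesgue. x \<noteq> (0::real)"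
    by (rule AE_completion[OF AE_lborel_singleton])
  then show ?thesis
    by eventually_elim (rule power_decay_product_bound[OF f \<phi>])
qed

lemma power_decay_product_measurable:
  assumes "power_decay a C f" "\<phi> \<in> borel_measurable borel"
  shows "(\<lambda>x. complex_of_real (f x) * \<phi> x) \<in> borel_measurable lebesgue"
proof -
  have "\<phi> \<in> borel_measurable lebesgue" using assms(2) by (intro measurable_completion) simp
  moreover have "f \<in> borel_measurable lebesgue" using assms(1) by (simp add: power_decay_def)
  ultimately show ?thesis by (intro borel_measurable_times measurable_compose[OF _ borel_measurable_of_real])
qed

lemma power_decay_product_integrable:
  assumes f: "power_decay a C f" and \<phi>: "\<phi> \<in> borel_measurable borel" "\<And>x. norm (\<phi> x) \<le> B / (1 + \<bar>x\<bar>)"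
  shows "integrable lebesgue (\<lambda>x. complex_of_real (f x) * \<phi> x)"
proof (rule Bochner_Integration.integrable_bound)
  show "integrable lebesgue (\<lambda>x. C * B * weight a x)"
    using f unfolding power_decay_def by (intro integrable_mult_right integrable_weight) auto
  show "(\<lambda>x. complex_of_real (f x) * \<phi> x) \<in> borel_measurable lebesgue"
    by (rule power_decay_product_measurable[OF f \<phi>(1)])
  show "AE x in lebesgue. norm (complex_of_real (f x) * \<phi> x) \<le> norm (C * B * weight a x)"
    using AE_power_decay_product_bound[OF f \<phi>(2)] by eventually_elim (use abs_ge_self order_trans in force)
qed

lemma norm_pairing_le:
  assumes f: "power_decay a C f" and \<phi>: "\<phi> \<in> borel_measurable borel" "\<And>x. norm (\<phi> x) \<le> B / (1 + \<bar>x\<bar>)"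
  shows "norm (pairing f \<phi>) \<le> C * B * (LINT x|lebesgue. weight a x)"
proof -
  have "norm (pairing f \<phi>) \<le> (LINT x|lebesgue. norm (complex_of_real (f x) * \<phi> x))"
    unfolding pairing_def by (rule integral_norm_bound)
  also have "\<dots> \<le> (LINT x|lebesgue. C * B * weight a x)"
    using f unfolding power_decay_def
    by (intro integral_mono_AE integrable_norm power_decay_product_integrable[OF f \<phi>]
        AE_power_decay_product_bound[OF f \<phi>(2)] integrable_mult_right integrable_weight) auto
  finally show ?thesis by simp
qed

lemma pairing_tendsto:
  assumes f: "power_decay a C f"
    and \<phi>: "\<And>n. \<phi> n \<in> borel_measurable borel" "\<And>n x. norm (\<phi> n x) \<le> B / (1 + \<bar>x\<bar>)"
    and lim: "\<And>x. (\<lambda>n. \<phi> n x) \<longlonglongrightarrow> \<psi> x"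
  shows "(\<lambda>n. pairing f (\<phi> n)) \<longlonglongrightarrow> pairing f \<psi>"
  unfolding pairing_def
proof (rule integral_dominated_convergence)
  have "\<psi> \<in> borel_measurable borel"
    by (rule borel_measurable_LIMSEQ_metric[OF \<phi>(1) lim])
  then show "(\<lambda>x. complex_of_real (f x) * \<psi> x) \<in> borel_measurable lebesgue"
    by (rule power_decay_product_measurable[OF f])
  show "(\<lambda>x. complex_of_real (f x) * \<phi> n x) \<in> borel_measurable lebesgue" for n
    by (rule power_decay_product_measurable[OF f \<phi>(1)])
  show "integrable lebesgue (\<lambda>x. C * B * weight a x)"
    using f unfolding power_decay_def by (intro integrable_mult_right integrable_weight) auto
  show "AE x in lebesgue. (\<lambda>n. complex_of_real (f x) * \<phi> n x) \<longlonglongrightarrow> complex_of_real (f x) * \<psi> x"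
    by (intro AE_I2 tendsto_intros lim)
  show "AE x in lebesgue. norm (complex_of_real (f x) * \<phi> n x) \<le> C * B * weight a x" for n
    by (rule AE_power_decay_product_bound[OF f \<phi>(2)])
qed

lemma norm_pairing_inverse_fourier_le:
  assumes "power_decay a C f" "test_function g"
  shows "norm (pairing f (inverse_fourier g)) \<le> C * w1_norm g * (LINT x|lebesgue. weight a x)"
  using assms by (intro norm_pairing_le inverse_fourier_measurable inverse_fourier_decay) auto

lemma pairing_inverse_fourier_add:
  assumes "power_decay a C f" "test_function g" "test_function h"
  shows "pairing f (inverse_fourier (\<lambda>\<xi>. g \<xi> + h \<xi>)) = pairing f (inverse_fourier g) + pairing f (inverse_fourier h)"
  unfolding pairing_def inverse_fourier_add[OF assms(2,3)] distrib_left
  using assms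
  by (intro Bochner_Integration.integral_add power_decay_product_integrable[OF assms(1) inverse_fourier_measurable inverse_fourier_decay])

lemma pairing_inverse_fourier_cmult:
  "pairing f (inverse_fourier (\<lambda>\<xi>. c * g \<xi>)) = c * pairing f (inverse_fourier g)"
proof -
  have "pairing f (inverse_fourier (\<lambda>\<xi>. c * g \<xi>)) = (LINT x|lebesgue. c * (complex_of_real (f x) * inverse_fourier g x))"
    unfolding pairing_def inverse_fourier_cmult by (simp add: mult_ac)
  then show ?thesis by (simp add: pairing_def)
qed

section \<open>Frequencies away from zero\<close>

text \<open>
  The equation reads \<open>(exp (R t) w)' = - R exp (R t) v\<close>. Integrating it from \<open>-\<infinity>\<close>, where
  \<open>exp (R t) w\<close> vanishes because \<open>w\<close> is bounded, bounds \<open>exp (R t) w t\<close> by \<open>B exp (R t)\<close>. This is the only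
  place where it matters that solutions are ancient.
\<close>
lemma backward_bounded_ode_bound:
  fixes v w :: "real \<Rightarrow> complex"
  assumes deriv: "\<And>t. t \<le> 0 \<Longrightarrow> (w has_vector_derivative - (of_real R * (v t + w t))) (at t within {..0})"
    and "R > 0" and w: "\<And>t. t \<le> 0 \<Longrightarrow> norm (w t) \<le> W" and v: "\<And>t. t \<le> 0 \<Longrightarrow> norm (v t) \<le> B"
    and "t \<le> 0"
  shows "norm (w t) \<le> B"
proof -
  define h where "h s = exp (R * s) *\<^sub>R w s" for s
  have h_deriv: "(h has_vector_derivative - (R * exp (R * s)) *\<^sub>R v s) (at s within {..0})" if "s \<le> 0" for s
  proof -
    have "((\<lambda>s. exp (R * s)) has_real_derivative R * exp (R * s)) (at s within {..0})"
      by (auto intro!: derivative_eq_intros)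
    from has_vector_derivative_scaleR[OF this deriv[OF that]] show ?thesis
      unfolding h_def[abs_def]
      by (rule has_vector_derivative_eq_rhs) (simp add: algebra_simps scaleR_conv_of_real)
  qed
  have diff: "norm (h t - h s) \<le> B * exp (R * t) - B * exp (R * s)" if "s < t" for s
  proof (rule differentiable_bound_general[OF that])
    have "continuous_on {..0} h"
      using h_deriv unfolding continuous_on_eq_continuous_within
      by (auto intro: has_vector_derivative_continuous)
    then show "continuous_on {s..t} h"
      by (rule continuous_on_subset) (use \<open>t \<le> 0\<close> in auto)
    show "continuous_on {s..t} (\<lambda>x. B * exp (R * x))"
      by (intro continuous_intros)
    fix x assume x: "s < x" "x < t"
    then have "at x within {..0} = at x"
      using \<open>t \<le> 0\<close> by (intro at_within_interior) auto
    then show "(h has_vector_derivative - (R * exp (R * x)) *\<^sub>R v x) (at x)"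
      using h_deriv[of x] x \<open>t \<le> 0\<close> by simp
    have "((\<lambda>x. B * exp (R * x)) has_real_derivative R * exp (R * x) * B) (at x)"
      by (auto intro!: derivative_eq_intros)
    then show "((\<lambda>x. B * exp (R * x)) has_vector_derivative R * exp (R * x) * B) (at x)"
      by (simp add: has_real_derivative_iff_has_vector_derivative)
    show "norm (- (R * exp (R * x)) *\<^sub>R v x) \<le> R * exp (R * x) * B"
      using v[of x] x \<open>t \<le> 0\<close> \<open>R > 0\<close> by (simp add: abs_mult mult_left_mono)
  qed
  have "norm (h t) \<le> B * exp (R * t) + (W - B) * exp (R * s)" if "s < t" for s
  proof -
    have "norm (h t) \<le> norm (h t - h s) + norm (h s)"
      using norm_triangle_ineq[of "h t - h s" "h s"] by simp
    also have "norm (h s) \<le> W * exp (R * s)"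
      using w[of s] that \<open>t \<le> 0\<close> by (simp add: h_def mult.commute)
    finally show ?thesis using diff[OF that] by (simp add: algebra_simps)
  qed
  then have "\<forall>\<^sub>F s in at_bot. norm (h t) \<le> B * exp (R * t) + (W - B) * exp (R * s)"
    by (rule eventually_mono[OF eventually_gt_at_bot[of t]])
  moreover have "((\<lambda>s. B * exp (R * t) + (W - B) * exp (R * s)) \<longlongrightarrow> B * exp (R * t) + (W - B) * 0) at_bot"
  proof (intro tendsto_intros)
    show "((\<lambda>s. exp (R * s)) \<longlongrightarrow> 0) at_bot"
      using \<open>R > 0\<close> by real_asymp
  qed
  ultimately have "norm (h t) \<le> B * exp (R * t) + (W - B) * 0"
    by (intro tendsto_lowerbound) auto
  then show ?thesis by (simp add: h_def mult.commute)
qed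

text \<open>
  Adding a bump at the origin to \<open>\<xi>\<^sup>2\<close> makes the base positive everywhere and changes nothing for
  \<open>\<bar>\<xi>\<bar> \<ge> \<delta>\<close>.
\<close>
lemma smooth_abs_powr_away_from_0:
  assumes "\<delta> > 0"
  obtains M :: "real \<Rightarrow> real" where "smooth M" "\<And>\<xi>. \<bar>\<xi>\<bar> \<ge> \<delta> \<Longrightarrow> M \<xi> = \<bar>\<xi>\<bar> powr \<alpha>"
proof
  have "smooth (\<lambda>\<xi>. bump ((1 / \<delta>) * \<xi>))"
    by (rule smooth_compose[OF smooth_bump]) (intro smooth_intros)
  then show "smooth (\<lambda>\<xi>. (\<xi>\<^sup>2 + bump ((1 / \<delta>) * \<xi>)) powr (\<alpha> / 2))"
  proof (intro smooth_powr smooth_intros)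
    show "\<xi>\<^sup>2 + bump ((1 / \<delta>) * \<xi>) > 0" for \<xi>
      using bump_nonneg[of "(1 / \<delta>) * \<xi>"] bump_pos_iff[of 0]
      by (cases "\<xi> = 0") (auto intro: add_pos_nonneg)
  qed
  show "(\<xi>\<^sup>2 + bump ((1 / \<delta>) * \<xi>)) powr (\<alpha> / 2) = \<bar>\<xi>\<bar> powr \<alpha>" if "\<bar>\<xi>\<bar> \<ge> \<delta>" for \<xi>
  proof -
    have "bump ((1 / \<delta>) * \<xi>) = 0" using that assms by (simp add: bump_eq_0_iff)
    moreover have "(\<bar>\<xi>\<bar> powr 2) powr (\<alpha> / 2) = \<bar>\<xi>\<bar> powr \<alpha>"
      unfolding powr_powr by simp
    moreover have "\<bar>\<xi>\<bar> powr 2 = \<xi>\<^sup>2" using that assms by (simp add: powr_numeral)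
    ultimately show ?thesis by simp
  qed
qed

text \<open>
  Differentiating the power costs only a factor \<open>n\<close>, which cannot compete with \<open>\<theta> ^ n\<close>.
\<close>
lemma w1_norm_power_mult_tendsto_0:
  assumes g: "test_function g" and m: "smooth m"
    and outside: "\<And>\<xi>. \<xi> \<notin> K \<Longrightarrow> g \<xi> = 0" "closed K"
    and inside: "\<And>\<xi>. \<xi> \<in> K \<Longrightarrow> norm (m \<xi>) \<le> \<theta>" and \<theta>: "0 \<le> \<theta>" "\<theta> < 1"
  shows "(\<lambda>n. w1_norm (\<lambda>\<xi>. m \<xi> ^ n * g \<xi>)) \<longlonglongrightarrow> 0"
proof -
  have ddx_outside: "ddx g \<xi> = 0" if "\<xi> \<notin> K" for \<xi>
    using ddx_eq_0_on_open[of "- K" g \<xi>] outside that by auto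
  let ?m' = "\<lambda>\<xi>. vector_derivative m (at \<xi>)"
  have tf: "test_function (\<lambda>\<xi>. m \<xi> ^ n * g \<xi>)" for n
    by (intro test_function_mult smooth_intros g m)
  have tf': "test_function (\<lambda>\<xi>. ?m' \<xi> * g \<xi>)"
    by (intro test_function_mult smooth_has_derivative(2) g m)
  define A B where "A = (LINT \<xi>|lborel. norm (g \<xi>)) + (LINT \<xi>|lborel. norm (ddx g \<xi>))"
    and "B = (LINT \<xi>|lborel. norm (?m' \<xi> * g \<xi>))"
  note int = integrable_norm[OF test_function_integrable[OF g]]
    integrable_norm[OF test_function_integrable[OF test_function_ddx[OF g]]]
    integrable_norm[OF test_function_integrable[OF tf']]
  have pow: "norm (m \<xi> ^ n * h) \<le> \<theta> ^ n * norm h" if "\<xi> \<notin> K \<Longrightarrow> h = 0" for \<xi> n h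
    using that inside[of \<xi>] by (cases "\<xi> \<in> K") (auto simp: norm_mult norm_power intro!: mult_right_mono power_mono)
  have upper: "w1_norm (\<lambda>\<xi>. m \<xi> ^ Suc n * g \<xi>) \<le> \<theta> ^ Suc n * A + Suc n * \<theta> ^ n * B" for n
  proof -
    have "norm (ddx (\<lambda>\<xi>. m \<xi> ^ Suc n * g \<xi>) \<xi>)
        \<le> Suc n * \<theta> ^ n * norm (?m' \<xi> * g \<xi>) + \<theta> ^ Suc n * norm (ddx g \<xi>)" for \<xi>
    proof -
      have "((\<lambda>\<xi>. m \<xi> ^ Suc n) has_vector_derivative of_nat (Suc n) * m \<xi> ^ n * ?m' \<xi>) (at \<xi>)"
        using smooth_has_derivative(1)[OF m, of \<xi>] unfolding has_vector_derivative_def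
        by (auto intro!: derivative_eq_intros simp del: power_Suc of_nat_Suc)
      from has_vector_derivative_mult[OF this smooth_has_derivative(1)[OF test_function_smooth[OF g]]]
      have "ddx (\<lambda>\<xi>. m \<xi> ^ Suc n * g \<xi>) \<xi>
          = m \<xi> ^ Suc n * ddx g \<xi> + of_nat (Suc n) * (m \<xi> ^ n * (?m' \<xi> * g \<xi>))"
        by (simp only: vector_derivative_at mult.assoc)
      also have "norm \<dots> \<le> \<theta> ^ Suc n * norm (ddx g \<xi>) + Suc n * (\<theta> ^ n * norm (?m' \<xi> * g \<xi>))"
      proof (intro norm_triangle_le add_mono)
        show "norm (m \<xi> ^ Suc n * ddx g \<xi>) \<le> \<theta> ^ Suc n * norm (ddx g \<xi>)"
          by (intro pow ddx_outside)
        have "norm (m \<xi> ^ n * (?m' \<xi> * g \<xi>)) \<le> \<theta> ^ n * norm (?m' \<xi> * g \<xi>)"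
          using outside(1) by (intro pow) simp
        then show "norm (of_nat (Suc n) * (m \<xi> ^ n * (?m' \<xi> * g \<xi>)))
            \<le> Suc n * (\<theta> ^ n * norm (?m' \<xi> * g \<xi>))"
          unfolding norm_mult[of "of_nat (Suc n)"] norm_of_nat by (rule mult_left_mono) simp
      qed
      finally show ?thesis by (simp only: mult.assoc add.commute)
    qed
    then have "(LINT \<xi>|lborel. norm (ddx (\<lambda>\<xi>. m \<xi> ^ Suc n * g \<xi>) \<xi>))
        \<le> (LINT \<xi>|lborel. Suc n * \<theta> ^ n * norm (?m' \<xi> * g \<xi>) + \<theta> ^ Suc n * norm (ddx g \<xi>))"
      by (intro integral_mono integrable_norm[OF test_function_integrable[OF test_function_ddx[OF tf]]]
          Bochner_Integration.integrable_add integrable_mult_right int)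
    also have "\<dots> = Suc n * \<theta> ^ n * B + \<theta> ^ Suc n * (LINT \<xi>|lborel. norm (ddx g \<xi>))"
      unfolding B_def integral_mult_right_zero[symmetric]
      by (intro Bochner_Integration.integral_add integrable_mult_right int)
    moreover have "(LINT \<xi>|lborel. norm (m \<xi> ^ Suc n * g \<xi>)) \<le> (LINT \<xi>|lborel. \<theta> ^ Suc n * norm (g \<xi>))"
      by (intro integral_mono integrable_norm[OF test_function_integrable[OF tf]]
          integrable_mult_right int pow outside(1))
    ultimately show ?thesis unfolding w1_norm_def A_def integral_mult_right_zero distrib_left by linarith
  qed
  have "(\<lambda>n. \<theta> ^ Suc n * A + Suc n * \<theta> ^ n * B) \<longlonglongrightarrow> 0 * A + (0 + 0) * B"
  proof -
    have p: "(\<lambda>n. \<theta> ^ n) \<longlonglongrightarrow> 0" using \<theta> by (intro LIMSEQ_realpow_zero)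
    have "(\<lambda>n. real n * \<theta> ^ n) \<longlonglongrightarrow> 0"
      using powser_times_n_limit_0[of \<theta>] \<theta> by simp
    then have "(\<lambda>n. (\<theta> ^ n + real n * \<theta> ^ n) * B) \<longlonglongrightarrow> (0 + 0) * B" by (intro tendsto_intros p)
    moreover have "(\<lambda>n. \<theta> ^ Suc n * A) \<longlonglongrightarrow> 0 * A" using LIMSEQ_Suc[OF p] by (intro tendsto_intros)
    ultimately show ?thesis
      using tendsto_add[of "\<lambda>n. \<theta> ^ Suc n * A" "0 * A" sequentially "\<lambda>n. (\<theta> ^ n + real n * \<theta> ^ n) * B"] by (simp add: algebra_simps)
  qed
  then have "(\<lambda>n. \<theta> ^ Suc n * A + Suc n * \<theta> ^ n * B) \<longlonglongrightarrow> 0" by simp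
  then have "(\<lambda>n. w1_norm (\<lambda>\<xi>. m \<xi> ^ Suc n * g \<xi>)) \<longlonglongrightarrow> 0"
  proof (rule tendsto_sandwich[OF _ _ tendsto_const, rotated 2])
    show "\<forall>\<^sub>F n in sequentially. 0 \<le> w1_norm (\<lambda>\<xi>. m \<xi> ^ Suc n * g \<xi>)"
      by (auto simp: w1_norm_def intro!: always_eventually add_nonneg_nonneg Bochner_Integration.integral_nonneg)
    show "\<forall>\<^sub>F n in sequentially. w1_norm (\<lambda>\<xi>. m \<xi> ^ Suc n * g \<xi>) \<le> \<theta> ^ Suc n * A + Suc n * \<theta> ^ n * B"
      using upper by (intro always_eventually allI)
  qed
  then show ?thesis by (rule LIMSEQ_imp_Suc)
qed

text \<open>
  Let \<open>R\<close> be the largest value of the symbol \<open>\<bar>\<xi>\<bar> powr \<alpha>\<close> on a set \<open>\<delta> \<le> \<bar>\<xi>\<bar> \<le> r\<close> containing the support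
  of \<open>g\<close>, and \<open>m = \<bar>\<xi>\<bar> powr \<alpha> / R - 1\<close>. Then \<open>\<bar>m\<bar> \<le> \<theta> < 1\<close> on that set. For the pairings \<open>w n\<close> of the solution with
  the inverse transforms of \<open>m ^ n g\<close> the equation becomes \<open>w n' = - R (w (n + 1) + w n)\<close>, so the
  supremum of \<open>\<bar>w n\<bar>\<close> is at most that of \<open>\<bar>w (n + 1)\<bar>\<close>. As \<open>n\<close> grows these suprema tend to zero
  with the norm of \<open>m ^ n g\<close>, hence \<open>w 0 = 0\<close>. Working with powers of \<open>m\<close> replaces the backward semigroup
  \<open>exp (s \<Lambda>\<^sup>\<alpha>)\<close>, and with it a product rule for pairings in which both factors depend on time.
\<close>
lemma pairing_eq_0_away_from_0:
  assumes decay: "\<And>t. t \<le> 0 \<Longrightarrow> power_decay a C (\<lambda>x. u x t)" and sol: "ancient_solution \<alpha> u" and "\<alpha> > 0"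
    and g: "test_function g" and "\<delta> > 0" and g0: "\<And>\<xi>. \<bar>\<xi>\<bar> < \<delta> \<Longrightarrow> g \<xi> = 0" and "t \<le> 0"
  shows "pairing (\<lambda>x. u x t) (inverse_fourier g) = 0"
proof -
  obtain r0 where r0: "\<And>\<xi>. \<bar>\<xi>\<bar> > r0 \<Longrightarrow> g \<xi> = 0" using g unfolding test_function_def by blast
  \<comment> \<open>the maximum gives \<open>r > 0\<close>, hence \<open>R > 0\<close>, also when \<open>g\<close> is zero\<close>
  define r where "r = max r0 \<delta>"
  define K where "K = {\<xi>. \<delta> \<le> \<bar>\<xi>\<bar> \<and> \<bar>\<xi>\<bar> \<le> r}"
  have outside: "g \<xi> = 0" if "\<xi> \<notin> K" for \<xi>
    using r0 g0 that by (auto simp: r_def K_def not_le)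
  define R where "R = r powr \<alpha>"
  define \<theta> where "\<theta> = 1 - \<delta> powr \<alpha> / R"
  have r: "r \<ge> \<delta>" by (simp add: r_def)
  have R: "R > 0" using r \<open>\<delta> > 0\<close> by (simp add: R_def)
  have "\<delta> powr \<alpha> \<le> R" unfolding R_def using r assms by (intro powr_mono2) auto
  then have \<theta>: "0 \<le> \<theta>" "\<theta> < 1" using R \<open>\<delta> > 0\<close> by (auto simp: \<theta>_def)
  obtain M where M: "smooth M" "\<And>\<xi>. \<bar>\<xi>\<bar> \<ge> \<delta> \<Longrightarrow> M \<xi> = \<bar>\<xi>\<bar> powr \<alpha>"
    using smooth_abs_powr_away_from_0[OF \<open>\<delta> > 0\<close>] by blast
  define m :: "real \<Rightarrow> complex" where "m \<xi> = of_real ((1 / R) * M \<xi> - 1)" for \<xi>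
  have m: "smooth m" unfolding m_def[abs_def] by (intro smooth_intros M)
  have m_le: "norm (m \<xi>) \<le> \<theta>" if "\<xi> \<in> K" for \<xi>
  proof -
    have "\<delta> powr \<alpha> \<le> \<bar>\<xi>\<bar> powr \<alpha>" "\<bar>\<xi>\<bar> powr \<alpha> \<le> R"
      using that assms unfolding K_def R_def by (auto intro!: powr_mono2)
    then show ?thesis using R M(2)[of \<xi>] that
      unfolding m_def norm_of_real \<theta>_def K_def by (simp add: abs_if field_simps)
  qed
  define G where "G n = (\<lambda>\<xi>. m \<xi> ^ n * g \<xi>)" for n
  have G: "test_function (G n)" for n
    unfolding G_def by (intro test_function_mult smooth_intros g m)
  have symbol: "of_real (\<bar>\<xi>\<bar> powr \<alpha>) * G n \<xi> = of_real R * (G (Suc n) \<xi> + G n \<xi>)" for n \<xi>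
  proof (cases "\<xi> \<in> K")
    case True
    then have "of_real (\<bar>\<xi>\<bar> powr \<alpha>) = of_real R * (m \<xi> + 1)"
      using R M(2)[of \<xi>] by (simp add: K_def m_def field_simps)
    then show ?thesis by (simp add: G_def algebra_simps)
  qed (simp add: G_def outside)
  define w where "w n t = pairing (\<lambda>x. u x t) (inverse_fourier (G n))" for n t
  have w_deriv: "(w n has_vector_derivative - (of_real R * (w (Suc n) t + w n t))) (at t within {..0})" if "t \<le> 0" for n t
  proof -
    have "pairing (\<lambda>x. u x t) (Lambda \<alpha> (inverse_fourier (G n)))
      = of_real R * (w (Suc n) t + w n t)"
      unfolding Lambda_inverse_fourier[OF G] symbol pairing_inverse_fourier_cmult w_def
      by (simp add: pairing_inverse_fourier_add[OF decay[OF that] G G])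
    moreover have "((\<lambda>s. pairing (\<lambda>x. u x s) (inverse_fourier (G n))) has_vector_derivative
        - pairing (\<lambda>x. u x t) (Lambda \<alpha> (inverse_fourier (G n)))) (at t within {..0})"
      using sol schwartz_inverse_fourier[OF G] that unfolding ancient_solution_def by blast
    ultimately show ?thesis by (simp add: w_def[abs_def])
  qed
  define B where "B n = C * w1_norm (G n) * (LINT x|lebesgue. weight a x)" for n
  have w_bound: "norm (w n t) \<le> B n" if "t \<le> 0" for n t
    unfolding w_def B_def by (rule norm_pairing_inverse_fourier_le[OF decay[OF that] G])
  have "norm (w 0 t) \<le> B n" if "t \<le> 0" for n t
  proof -
    have "norm (w k t) \<le> B (k + n)" if "t \<le> 0" for k t
      using that
    proof (induction n arbitrary: k t)
      case (Suc n)
      have "norm (w k t) \<le> B (Suc k + n)"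
        by (rule backward_bounded_ode_bound[OF w_deriv R w_bound Suc.IH Suc.prems])
      then show ?case by simp
    qed (simp add: w_bound)
    from this[of t 0] that show ?thesis by simp
  qed
  moreover have "B \<longlonglongrightarrow> 0"
  proof -
    have "closed K" unfolding K_def by (intro closed_Collect_conj closed_Collect_le continuous_intros)
    from w1_norm_power_mult_tendsto_0[OF g m outside this m_le \<theta>]
    have "(\<lambda>n. w1_norm (G n)) \<longlonglongrightarrow> 0" by (simp add: G_def)
    then have "B \<longlonglongrightarrow> C * 0 * (LINT x|lebesgue. weight a x)"
      unfolding B_def[abs_def] by (intro tendsto_intros)
    then show ?thesis by simp
  qed
  ultimately have "norm (w 0 t) \<le> 0"
    using \<open>t \<le> 0\<close> by (intro tendsto_lowerbound[of B]) auto
  then show ?thesis by (simp add: w_def G_def)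
qed

section \<open>The frequency zero\<close>

lemma smooth_dilate: "smooth f \<Longrightarrow> smooth (\<lambda>\<xi>. f (c * \<xi>))"
  by (rule smooth_compose[OF _ smooth_mult[OF smooth_const smooth_ident]])

lemma has_vector_derivative_dilate:
  assumes "smooth f"
  shows "((\<lambda>\<xi>. f (c * \<xi>)) has_vector_derivative c *\<^sub>R vector_derivative f (at (c * \<xi>))) (at \<xi>)"
proof (rule vector_diff_chain_at[unfolded o_def])
  show "((\<lambda>\<xi>. c * \<xi>) has_vector_derivative c) (at \<xi>)"
    unfolding has_real_derivative_iff_has_vector_derivative[symmetric]
    by (auto intro!: derivative_eq_intros)
qed (rule smooth_has_derivative[OF assms])

lemma integral_norm_dilate:
  fixes f :: "real \<Rightarrow> complex"
  assumes "c > 0"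
  shows "(LINT \<xi>|lborel. norm (f (c * \<xi>))) = (LINT \<xi>|lborel. norm (f \<xi>)) / c"
  using lborel_integral_real_affine[of c "\<lambda>\<xi>. norm (f \<xi>)" 0] assms by simp

lemma test_function_dilate_integrable:
  assumes "test_function f" "c > 0"
  shows "integrable lborel (\<lambda>\<xi>. norm (f (c * \<xi>)))"
  using lborel_integrable_real_affine[OF integrable_norm[OF test_function_integrable[OF assms(1)]], of c 0] assms(2)
  by simp

text \<open>
  The part of \<open>g\<close> in a window of width \<open>1 / n\<close> around the origin has an \<open>L\<^sup>1\<close> norm of order \<open>1 / n\<close>,
  so its inverse transform tends to zero uniformly. Its derivative is of size \<open>n\<close> but lives on the
  same window, so the \<open>W\<^bsup>1,1\<^esup>\<close> norm stays bounded, and this provides the dominating function.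
  For a constant \<open>f\<close> the limit can be nonzero; the decay of \<open>f\<close> excludes this.
\<close>
lemma pairing_shrinking_cutoff_tendsto_0:
  assumes f: "power_decay a C f" and g: "test_function g" and \<kappa>: "test_function \<kappa>"
  shows "(\<lambda>n. pairing f (inverse_fourier (\<lambda>\<xi>. \<kappa> (real (Suc n) * \<xi>) * g \<xi>))) \<longlonglongrightarrow> 0"
proof -
  define h where "h n = (\<lambda>\<xi>. \<kappa> (real (Suc n) * \<xi>) * g \<xi>)" for n
  have h: "test_function (h n)" for n
    unfolding h_def by (rule test_function_mult[OF smooth_dilate[OF test_function_smooth[OF \<kappa>]] g])
  obtain G where G: "\<And>\<xi>. norm (g \<xi>) \<le> G" using test_function_bound[OF g] by blast
  obtain K where K: "\<And>\<xi>. norm (\<kappa> \<xi>) \<le> K" using test_function_bound[OF \<kappa>] by blast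
  have G0: "G \<ge> 0" using G norm_ge_zero order_trans by blast
  define P P' D where "P = (LINT \<xi>|lborel. norm (\<kappa> \<xi>))" and "P' = (LINT \<xi>|lborel. norm (ddx \<kappa> \<xi>))"
    and "D = (LINT \<xi>|lborel. norm (ddx g \<xi>))"
  have P0: "P \<ge> 0" by (simp add: P_def)
  note int = test_function_dilate_integrable[OF \<kappa>] test_function_dilate_integrable[OF test_function_ddx[OF \<kappa>]]
     integrable_norm[OF test_function_integrable[OF test_function_ddx[OF g]]]
  have h_L1: "(LINT \<xi>|lborel. norm (h n \<xi>)) \<le> G * (P / Suc n)" for n
  proof -
    have "(LINT \<xi>|lborel. norm (h n \<xi>)) \<le> (LINT \<xi>|lborel. G * norm (\<kappa> (real (Suc n) * \<xi>)))"
    proof (intro integral_mono integrable_norm[OF test_function_integrable[OF h]] integrable_mult_right int)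
      show "norm (h n \<xi>) \<le> G * norm (\<kappa> (real (Suc n) * \<xi>))" for \<xi>
        unfolding h_def norm_mult by (subst mult.commute) (intro mult_right_mono G norm_ge_zero)
    qed simp
    also have "\<dots> = G * (P / Suc n)"
      unfolding integral_mult_right_zero P_def by (subst integral_norm_dilate) auto
    finally show ?thesis .
  qed
  have ddx_h_L1: "(LINT \<xi>|lborel. norm (ddx (h n) \<xi>)) \<le> K * D + G * P'" for n
  proof -
    have le: "norm (ddx (h n) \<xi>) \<le> K * norm (ddx g \<xi>) + (G * Suc n) * norm (ddx \<kappa> (real (Suc n) * \<xi>))" for \<xi>
    proof -
      have "ddx (h n) \<xi> = \<kappa> (real (Suc n) * \<xi>) * ddx g \<xi> + (real (Suc n) *\<^sub>R ddx \<kappa> (real (Suc n) * \<xi>)) * g \<xi>"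
        unfolding h_def
        by (rule vector_derivative_at, rule has_vector_derivative_mult)
           (rule has_vector_derivative_dilate smooth_has_derivative test_function_smooth g \<kappa>)+
      also have "norm \<dots> \<le> norm (\<kappa> (real (Suc n) * \<xi>)) * norm (ddx g \<xi>) + (real (Suc n) * norm (ddx \<kappa> (real (Suc n) * \<xi>))) * norm (g \<xi>)"
        by (rule norm_triangle_le) (simp add: norm_mult)
      also have "\<dots> \<le> K * norm (ddx g \<xi>) + (real (Suc n) * norm (ddx \<kappa> (real (Suc n) * \<xi>))) * G"
        by (intro add_mono mult_right_mono mult_left_mono G K mult_nonneg_nonneg) auto
      finally show ?thesis by (simp add: mult_ac)
    qed
    have "(LINT \<xi>|lborel. norm (ddx (h n) \<xi>))
       \<le> (LINT \<xi>|lborel. K * norm (ddx g \<xi>) + (G * Suc n) * norm (ddx \<kappa> (real (Suc n) * \<xi>)))"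
      by (intro integral_mono integrable_norm[OF test_function_integrable[OF test_function_ddx[OF h]]]
          Bochner_Integration.integrable_add integrable_mult_right int le) simp
    also have "\<dots> = (LINT \<xi>|lborel. K * norm (ddx g \<xi>)) + (LINT \<xi>|lborel. (G * Suc n) * norm (ddx \<kappa> (real (Suc n) * \<xi>)))"
      by (intro Bochner_Integration.integral_add integrable_mult_right int) simp
    also have "\<dots> = K * D + G * P'"
      unfolding integral_mult_right_zero D_def P'_def by (subst integral_norm_dilate) auto
    finally show ?thesis .
  qed
  have "(\<lambda>n. pairing f (inverse_fourier (h n))) \<longlonglongrightarrow> pairing f (\<lambda>x. 0)"
  proof (rule pairing_tendsto[OF f])
    show "inverse_fourier (h n) \<in> borel_measurable borel" for n by (rule inverse_fourier_measurable[OF h])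
    show "norm (inverse_fourier (h n) x) \<le> (G * P + (K * D + G * P')) / (1 + \<bar>x\<bar>)" for n x
    proof -
      have "G * (P / Suc n) \<le> G * (P / 1)"
        using G0 P0 by (intro mult_left_mono divide_left_mono) auto
      with h_L1[of n] ddx_h_L1[of n] have "w1_norm (h n) \<le> G * P + (K * D + G * P')"
        unfolding w1_norm_def by linarith
      with inverse_fourier_decay[OF h, of n x] show ?thesis
        by (rule order_trans[OF _ divide_right_mono]) simp
    qed
    show "(\<lambda>n. inverse_fourier (h n) x) \<longlonglongrightarrow> 0" for x
    proof (rule Lim_null_comparison)
      have "norm (inverse_fourier (h n) x) \<le> G * (P / Suc n) / (2 * pi)" for n
        using inverse_fourier_norm_le[OF test_function_integrable[OF h], of n x] h_L1[of n]
        by (rule order_trans[OF _ divide_right_mono]) simp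
      then show "\<forall>\<^sub>F n in sequentially. norm (inverse_fourier (h n) x) \<le> G * (P / Suc n) / (2 * pi)" by simp
      show "(\<lambda>n. G * (P / Suc n) / (2 * pi)) \<longlonglongrightarrow> 0" by real_asymp
    qed
  qed
  then show ?thesis by (simp add: h_def pairing_def)
qed

lemma pairing_eq_0:
  assumes decay: "\<And>t. t \<le> 0 \<Longrightarrow> power_decay a C (\<lambda>x. u x t)" and sol: "ancient_solution \<alpha> u" and "\<alpha> > 0"
    and g: "test_function g" and "t \<le> 0"
  shows "pairing (\<lambda>x. u x t) (inverse_fourier g) = 0"
proof -
  define \<kappa> :: "real \<Rightarrow> complex" where "\<kappa> \<xi> = of_real (plateau \<xi>)" for \<xi>
  have \<kappa>: "test_function \<kappa>"
    unfolding test_function_def \<kappa>_def[abs_def]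
    by (intro conjI smooth_intros smooth_plateau exI[of _ 1]) (simp add: plateau_eq_0)
  obtain d where d: "d > 0" "\<And>\<xi>. \<bar>\<xi>\<bar> < d \<Longrightarrow> \<kappa> \<xi> = 1"
    using plateau_eq_1 unfolding \<kappa>_def by auto
  let ?h = "\<lambda>n \<xi>. \<kappa> (real (Suc n) * \<xi>) * g \<xi>"
  have "pairing (\<lambda>x. u x t) (inverse_fourier g) = pairing (\<lambda>x. u x t) (inverse_fourier (?h n))" for n
  proof -
    let ?k = "\<lambda>\<xi>. (1 - \<kappa> (real (Suc n) * \<xi>)) * g \<xi>"
    have "smooth (\<lambda>\<xi>. \<kappa> (real (Suc n) * \<xi>))"
      by (rule smooth_dilate[OF test_function_smooth[OF \<kappa>]])
    then have tf: "test_function (?h n)" "test_function ?k"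
      by (auto intro!: test_function_mult smooth_diff smooth_const g)
    have near_0: "?k \<xi> = 0" if "\<bar>\<xi>\<bar> < d / Suc n" for \<xi>
    proof -
      have "\<bar>real (Suc n) * \<xi>\<bar> < d"
        using that by (simp add: abs_mult pos_less_divide_eq mult.commute del: of_nat_Suc)
      then show ?thesis by (simp only: d(2)) simp
    qed
    have "d / Suc n > 0" using d(1) by simp
    from pairing_eq_0_away_from_0[OF decay sol \<open>\<alpha> > 0\<close> tf(2) this near_0 \<open>t \<le> 0\<close>]
    have "pairing (\<lambda>x. u x t) (inverse_fourier ?k) = 0" .
    moreover have "g = (\<lambda>\<xi>. ?h n \<xi> + ?k \<xi>)" by (simp add: algebra_simps)
    ultimately show ?thesis
      using pairing_inverse_fourier_add[OF decay[OF \<open>t \<le> 0\<close>] tf] by simp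
  qed
  then have "(\<lambda>n. pairing (\<lambda>x. u x t) (inverse_fourier g)) \<longlonglongrightarrow> 0"
    using pairing_shrinking_cutoff_tendsto_0[OF decay[OF \<open>t \<le> 0\<close>] g \<kappa>] by simp
  then show ?thesis by (simp add: LIMSEQ_const_iff)
qed

section \<open>Uniqueness of the Fourier transform and conclusion\<close>

text \<open>
  Unless \<open>f\<close> vanishes almost everywhere, its positive and negative part are, up to a common factor,
  the densities of two probability measures with equal characteristic functions.
\<close>
lemma AE_zero_if_fourier_zero:
  fixes f :: "real \<Rightarrow> real"
  assumes f: "integrable lborel f"
    and zero: "\<And>\<eta>. (LINT x|lborel. cis (\<eta> * x) * of_real (f x)) = 0"
  shows "AE x in lborel. f x = 0"
proof -
  define p q where "p x = max 0 (f x)" and "q x = max 0 (- f x)" for x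
  have [measurable]: "f \<in> borel_measurable borel" using f by auto
  have [measurable]: "p \<in> borel_measurable borel" "q \<in> borel_measurable borel"
    unfolding p_def[abs_def] q_def[abs_def] by measurable
  have pq: "f x = p x - q x" "p x \<ge> 0" "q x \<ge> 0" for x by (auto simp: p_def q_def)
  have p: "integrable lborel p" and q: "integrable lborel q"
    unfolding p_def[abs_def] q_def[abs_def] using f by auto
  have cis_int: "integrable lborel (\<lambda>x. cis (\<eta> * x) * of_real (h x))" if "integrable lborel h" for h :: "real \<Rightarrow> real" and \<eta>
  proof (rule Bochner_Integration.integrable_bound[OF that])
    have [measurable]: "h \<in> borel_measurable borel" using that by auto
    show "(\<lambda>x. cis (\<eta> * x) * of_real (h x)) \<in> borel_measurable lborel"
      unfolding cis_conv_exp by measurable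
  qed (simp add: norm_mult)
  have transform_eq: "(LINT x|lborel. cis (\<eta> * x) * of_real (p x)) = (LINT x|lborel. cis (\<eta> * x) * of_real (q x))" for \<eta>
    using zero[of \<eta>] unfolding pq(1) of_real_diff right_diff_distrib
    by (subst (asm) Bochner_Integration.integral_diff[OF cis_int[OF p] cis_int[OF q]]) simp
  define c where "c = (LINT x|lborel. p x)"
  have c_q: "c = (LINT x|lborel. q x)"
    using transform_eq[of 0] unfolding c_def by (simp add: complex_eq_iff)
  show ?thesis
  proof (cases "c = 0")
    case True
    have "AE x in lborel. p x = 0" "AE x in lborel. q x = 0"
      using True c_q c_def integral_nonneg_eq_0_iff_AE[OF p] integral_nonneg_eq_0_iff_AE[OF q] pq by auto
    then show ?thesis by eventually_elim (simp add: pq)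
  next
    case False
    then have c: "c > 0" using pq(2) by (simp add: c_def order_less_le Bochner_Integration.integral_nonneg)
    define M where "M h = density lborel (\<lambda>x. ennreal (h x / c))" for h :: "real \<Rightarrow> real"
    have M: "real_distribution (M h)" "char (M h) \<eta> = (LINT x|lborel. cis (\<eta> * x) * of_real (h x)) / c"
      if h: "integrable lborel h" "\<And>x. h x \<ge> 0" "(LINT x|lborel. h x) = c" for h \<eta>
    proof -
      have [measurable]: "h \<in> borel_measurable borel" using h(1) by auto
      have "emeasure (M h) (space (M h)) = (\<integral>\<^sup>+ x. ennreal (h x / c) \<partial>lborel)"
        by (simp add: M_def emeasure_density)
      also have "\<dots> = ennreal (LINT x|lborel. h x / c)"
        using h c by (intro nn_integral_eq_integral) auto
      also have "\<dots> = 1" using h(3) c by simp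
      finally have "prob_space (M h)" by (rule prob_spaceI)
      then show "real_distribution (M h)"
        by (simp add: real_distribution_def real_distribution_axioms_def M_def)
      have "char (M h) \<eta> = (LINT x|lborel. (h x / c) *\<^sub>R iexp (\<eta> * x))"
        unfolding char_def M_def using h(2) c by (intro integral_density) auto
      also have "\<dots> = (LINT x|lborel. cis (\<eta> * x) * of_real (h x) / of_real c)"
        by (simp add: cis_conv_exp scaleR_conv_of_real mult.commute)
      finally show "char (M h) \<eta> = (LINT x|lborel. cis (\<eta> * x) * of_real (h x)) / c" by simp
    qed
    note Mp = M[OF p pq(2) c_def[symmetric]] and Mq = M[OF q pq(3) c_q[symmetric]]
    have "M p = M q"
      by (rule Levy_uniqueness[OF Mp(1) Mq(1)]) (simp add: fun_eq_iff Mp(2) Mq(2) transform_eq)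
    then have "AE x in lborel. ennreal (p x / c) = ennreal (q x / c)"
      unfolding M_def by (intro sigma_finite_measure.density_unique[OF sigma_finite_lborel]) auto
    then show ?thesis
      by eventually_elim (use c pq in auto)
  qed
qed

lemma AE_zero_if_fourier_zero_lebesgue:
  fixes f :: "real \<Rightarrow> real"
  assumes f: "integrable lebesgue f"
    and zero: "\<And>\<eta>. (LINT x|lebesgue. cis (\<eta> * x) * of_real (f x)) = 0"
  shows "AE x in lebesgue. f x = 0"
proof -
  obtain g where g [measurable]: "g \<in> borel_measurable lborel" and fg: "AE x in lborel. f x = g x"
    using completion_ex_borel_measurable_real[OF borel_measurable_integrable[OF f]] by auto
  have fg': "AE x in lebesgue. f x = g x" using fg by (rule AE_completion)
  have g_leb: "g \<in> borel_measurable lebesgue" using g by (rule measurable_completion)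
  have "integrable lebesgue g"
    using integrable_cong_AE[OF borel_measurable_integrable[OF f] g_leb fg'] f by simp
  then have int: "integrable lborel g" by (simp add: integrable_completion)
  have meas: "(\<lambda>x. cis (\<eta> * x) * of_real (g x)) \<in> borel_measurable lborel" for \<eta>
    unfolding cis_conv_exp by measurable
  have "(LINT x|lborel. cis (\<eta> * x) * of_real (g x)) = 0" for \<eta>
  proof -
    have "(\<lambda>x. cis (\<eta> * x)) \<in> borel_measurable lborel" unfolding cis_conv_exp by measurable
    then have "(\<lambda>x. cis (\<eta> * x)) \<in> borel_measurable lebesgue" by (rule measurable_completion)
    then have meas_f: "(\<lambda>x. cis (\<eta> * x) * of_real (f x)) \<in> borel_measurable lebesgue"
      using f by (intro borel_measurable_times measurable_compose[OF _ borel_measurable_of_real]) auto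
    have "(LINT x|lebesgue. cis (\<eta> * x) * of_real (f x)) = (LINT x|lebesgue. cis (\<eta> * x) * of_real (g x))"
      using fg' by (intro integral_cong_AE meas_f measurable_completion[OF meas]) (auto elim: eventually_mono)
    then show ?thesis using zero[of \<eta>] integral_completion[OF meas] by simp
  qed
  then have "AE x in lborel. g x = 0" by (rule AE_zero_if_fourier_zero[OF int])
  then have "AE x in lebesgue. g x = 0" by (rule AE_completion)
  with fg' show ?thesis by eventually_elim simp
qed

lemma inverse_fourier_dilate_translate:
  assumes g: "test_function g" and "k > 0"
  shows "test_function (\<lambda>\<xi>. of_real k * g (k * (\<xi> - \<eta>)))"
    and "inverse_fourier (\<lambda>\<xi>. of_real k * g (k * (\<xi> - \<eta>))) x = cis (\<eta> * x) * inverse_fourier g (x / k)"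
proof -
  have "smooth (\<lambda>\<xi>. g (k * (\<xi> - \<eta>)))"
    by (rule smooth_compose[OF test_function_smooth[OF g]]) (intro smooth_intros)
  moreover obtain r where r: "\<And>\<xi>. \<bar>\<xi>\<bar> > r \<Longrightarrow> g \<xi> = 0" using g unfolding test_function_def by blast
  have "g (k * (\<xi> - \<eta>)) = 0" if "\<bar>\<xi>\<bar> > r / k + \<bar>\<eta>\<bar>" for \<xi>
  proof (rule r)
    have "r / k < \<bar>\<xi> - \<eta>\<bar>" using that by linarith
    then show "r < \<bar>k * (\<xi> - \<eta>)\<bar>" using \<open>k > 0\<close> by (simp add: abs_mult pos_divide_less_eq mult.commute)
  qed
  ultimately have "test_function (\<lambda>\<xi>. g (k * (\<xi> - \<eta>)))" unfolding test_function_def by blast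
  then show "test_function (\<lambda>\<xi>. of_real k * g (k * (\<xi> - \<eta>)))" by (intro test_function_mult smooth_const)
  let ?F = "\<lambda>\<zeta>. cis (x * (\<zeta> / k + \<eta>)) * g \<zeta>"
  have "(LINT \<zeta>|lborel. ?F \<zeta>) = \<bar>k\<bar> *\<^sub>R (LINT \<xi>|lborel. ?F (- (k * \<eta>) + k * \<xi>))"
    using \<open>k > 0\<close> by (intro lborel_integral_real_affine) simp
  also have "(\<lambda>\<xi>. ?F (- (k * \<eta>) + k * \<xi>)) = (\<lambda>\<xi>. cis (x * \<xi>) * g (k * (\<xi> - \<eta>)))"
    using \<open>k > 0\<close> by (auto simp: field_simps)
  finally have "(LINT \<xi>|lborel. cis (x * \<xi>) * (of_real k * g (k * (\<xi> - \<eta>)))) = (LINT \<zeta>|lborel. ?F \<zeta>)"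
    using \<open>k > 0\<close> by (simp add: scaleR_conv_of_real mult.left_commute)
  also have "\<dots> = (LINT \<zeta>|lborel. cis (\<eta> * x) * (cis (x / k * \<zeta>) * g \<zeta>))"
    by (simp add: cis_mult[symmetric] distrib_left mult_ac)
  finally show "inverse_fourier (\<lambda>\<xi>. of_real k * g (k * (\<xi> - \<eta>))) x = cis (\<eta> * x) * inverse_fourier g (x / k)"
    by (simp add: inverse_fourier_def)
qed

text \<open>
  Let \<open>\<phi>\<close> be the inverse transform of a bump. Its dilates, multiplied by characters, are again
  inverse transforms of test functions, so \<open>f x * \<phi> (x / k)\<close> and its real part have zero Fourier
  transform, and the real part vanishes almost everywhere. For \<open>k \<rightarrow> \<infinity>\<close> the real part of
  \<open>\<phi> (x / k)\<close> tends to that of \<open>\<phi> 0\<close>, the positive integral of the bump up to a factor. Dilating in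
  this way avoids asking where \<open>\<phi>\<close> has zeros.
\<close>
lemma AE_zero_if_pairing_zero:
  assumes f: "power_decay a C f" and zero: "\<And>g. test_function g \<Longrightarrow> pairing f (inverse_fourier g) = 0"
  shows "AE x in lebesgue. f x = 0"
proof -
  define b :: "real \<Rightarrow> complex" where "b \<xi> = of_real (bump \<xi>)" for \<xi>
  have b: "test_function b"
    unfolding test_function_def b_def[abs_def]
    by (intro conjI smooth_intros smooth_bump exI[of _ 1]) (simp add: bump_eq_0_iff)
  define \<phi> where "\<phi> = inverse_fourier b"
  have b_int: "integrable lborel bump"
    using integrable_Re[OF test_function_integrable[OF b]] by (simp add: b_def)
  have Re_\<phi>_0: "Re (\<phi> 0) \<noteq> 0"
  proof -
    have "(LINT \<xi>|lborel. bump \<xi>) \<noteq> 0"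
    proof
      assume "(LINT \<xi>|lborel. bump \<xi>) = 0"
      then have "AE \<xi> in lborel. bump \<xi> = 0"
        using integral_nonneg_eq_0_iff_AE[OF b_int] bump_nonneg by simp
      then have "AE \<xi> in lborel. \<not> \<bar>\<xi>\<bar> < (1::real)"
        by eventually_elim (simp add: bump_eq_0_iff)
      then have "emeasure lborel {\<xi>. \<bar>\<xi>\<bar> < (1::real)} = 0"
        by (subst (asm) AE_iff_measurable[of "{\<xi>. \<bar>\<xi>\<bar> < (1::real)}"]) auto
      moreover have "{\<xi>. \<bar>\<xi>\<bar> < (1::real)} = {-1<..<1}" by auto
      ultimately show False by simp
    qed
    moreover have "\<phi> 0 = of_real ((LINT \<xi>|lborel. bump \<xi>) / (2 * pi))"
      by (simp add: \<phi>_def inverse_fourier_def b_def)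
    ultimately show ?thesis by simp
  qed
  have vanish: "AE x in lebesgue. f x * Re (\<phi> (x / k)) = 0" if "k > 0" for k
  proof (rule AE_zero_if_fourier_zero_lebesgue)
    note dil = inverse_fourier_dilate_translate[OF b that]
    have int: "integrable lebesgue (\<lambda>x. cis (\<eta> * x) * (of_real (f x) * \<phi> (x / k)))" for \<eta>
      using power_decay_product_integrable[OF f inverse_fourier_measurable[OF dil(1)] inverse_fourier_decay[OF dil(1)], of \<eta>]
      unfolding dil(2) \<phi>_def by (simp add: mult_ac)
    have 0: "(LINT x|lebesgue. cis (\<eta> * x) * (of_real (f x) * \<phi> (x / k))) = 0" for \<eta>
      using zero[OF dil(1), of \<eta>] unfolding pairing_def dil(2) \<phi>_def by (simp add: mult_ac)
    have "integrable lebesgue (\<lambda>x. Re (cis (0 * x) * (of_real (f x) * \<phi> (x / k))))"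
      by (intro integrable_Re int)
    then show "integrable lebesgue (\<lambda>x. f x * Re (\<phi> (x / k)))" by simp
    fix \<eta>
    \<comment> \<open>the real part of \<open>\<phi>\<close> is half the sum of \<open>\<phi>\<close> and its conjugate, whose transform at \<open>\<eta>\<close>
      is the conjugate of the transform at \<open>- \<eta>\<close>\<close>
    have "cis (\<eta> * x) * of_real (f x * Re (\<phi> (x / k)))
      = (cis (\<eta> * x) * (of_real (f x) * \<phi> (x / k)) + cnj (cis (- \<eta> * x) * (of_real (f x) * \<phi> (x / k)))) / 2" for x
      by (simp add: cis_cnj complex_eq_iff field_simps)
    then have "(LINT x|lebesgue. cis (\<eta> * x) * of_real (f x * Re (\<phi> (x / k))))
      = (LINT x|lebesgue. (cis (\<eta> * x) * (of_real (f x) * \<phi> (x / k)) + cnj (cis (- \<eta> * x) * (of_real (f x) * \<phi> (x / k)))) / 2)"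
      by (simp only:)
    also have "\<dots> = ((LINT x|lebesgue. cis (\<eta> * x) * (of_real (f x) * \<phi> (x / k)))
        + cnj (LINT x|lebesgue. cis (- \<eta> * x) * (of_real (f x) * \<phi> (x / k)))) / 2"
      unfolding integral_divide_zero
      by (subst Bochner_Integration.integral_add[OF int integrable_cnj[OF int]]) (simp only: Bochner_Integration.integral_cnj)
    also have "\<dots> = 0" unfolding 0 by simp
    finally show "(LINT x|lebesgue. cis (\<eta> * x) * of_real (f x * Re (\<phi> (x / k)))) = 0" .
  qed
  have "AE x in lebesgue. \<forall>n. f x * Re (\<phi> (x / real (Suc n))) = 0"
    unfolding AE_all_countable using vanish by simp
  then show ?thesis
  proof eventually_elim
    fix x assume x: "\<forall>n. f x * Re (\<phi> (x / real (Suc n))) = 0"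
    have "isCont \<phi> 0"
      using inverse_fourier_continuous[OF b, of UNIV] continuous_on_eq_continuous_at[OF open_UNIV] unfolding \<phi>_def by auto
    moreover have "(\<lambda>n. x / real (Suc n)) \<longlonglongrightarrow> 0" by real_asymp
    ultimately have "(\<lambda>n. \<phi> (x / real (Suc n))) \<longlonglongrightarrow> \<phi> 0" by (rule isCont_tendsto_compose)
    then have "(\<lambda>n. f x * Re (\<phi> (x / real (Suc n)))) \<longlonglongrightarrow> f x * Re (\<phi> 0)" by (intro tendsto_intros)
    then have "f x * Re (\<phi> 0) = 0"
      unfolding x[rule_format] LIMSEQ_const_iff by simp
    with Re_\<phi>_0 show "f x = 0" by simp
  qed
qed

theorem theorem1p2:
  fixes a \<alpha> C :: real and u :: "real \<Rightarrow> real \<Rightarrow> real"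
  assumes "0 < a" and "a < 1"
    and "0 < \<alpha>" and "\<alpha> \<le> 2"
    and "C > 0"
    and "\<And>t. t \<le> 0 \<Longrightarrow> (\<lambda>x. u x t) \<in> borel_measurable lebesgue"
    and "\<And>x t. t \<le> 0 \<Longrightarrow> \<bar>x\<bar> powr a * \<bar>u x t\<bar> \<le> C"
    and "ancient_solution \<alpha> u"
  shows "\<forall>t\<le>0. AE x in lebesgue. u x t = 0"
proof (intro allI impI)
  fix t :: real assume "t \<le> 0"
  have decay: "power_decay a C (\<lambda>x. u x t)" if "t \<le> 0" for t
    using assms that by (simp add: power_decay_def)
  show "AE x in lebesgue. u x t = 0"
    using AE_zero_if_pairing_zero[OF decay[OF \<open>t \<le> 0\<close>]] pairing_eq_0[OF decay assms(8,3) _ \<open>t \<le> 0\<close>] by blast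
qed

end
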